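(* Let $F=\bigsqcup_{\alpha=1}^{j}T_\alpha$ be a forest consisting of $j\ge 1$ finite rooted binary trees and having $i$ nodes in total, let $w$ be a weight on $F$, and put $m=i+j$. Let $\varphi(F,w):(\mathbb P^1)^j\to\mathbb P^m(\mathbb C)$ be the map attached to $(F,w)$ (see context). Then $$\operatorname{im}\varphi(F,w)\subset X(m,i).$$
   Context: All varieties are over $\mathbb C$. The variety $X(m,i)$. For $m\ge 2$ and $a_0,\dots,a_m$ (with $a_\kappa=0$ for $\kappa\notin\{0,\dots,m\}$) let $\mathfrak M(m)(a_0,\dots,a_m)$ be the $(m-1)\times(m-1)$ matrix whose $(\alpha,\beta)$ entry is $a_{2\beta-\alpha}$. Let $D(m,\iota)\in\mathbb Z[a_0,\dots,a_m]$ be the coefficient of $U^{\iota}$ in $\det(\mathfrak M(m)(a_0,\dots,a_m)-U\cdot I_{m-1})$; it is homogeneous of degree $m-1-\iota$. For $m>i\ge1$, $X(m,i)\subset\mathbb P^m(\mathbb C)$ is the set of points $(a_0:\dots:a_m)$ with $D(m,\iota)(a_0,\dots,a_m)=0$ for $\iota=0,\dots,i-1$. Trees, forests. A tree is a finite rooted tree in which every node has at most $2$ right neighbors (children). A node is final if it has no child, and a ramification node if it has exactly two children. The depth of a node is its distance to the root (the root has depth $0$); the depth $d_\alpha$ of a tree $T_\alpha$ is the maximal depth of its nodes. A forest is a disjoint union of trees. Weights. A (multiplicative) weight on a tree $T$ of depth $d$ is a function $w$ from the nodes of $T$ to the group of $2^d$-th roots of unity in $\mathbb C^*$ such that: $w(\text{root})=1$;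 if $y$ is the parent of $x$ then $w(y)=w(x)^2$; if $x_1,x_2$ are the two children of a ramification node then $w(x_2)=-w(x_1)$. A weight on a forest is a choice of a weight on each of its trees. The map $\varphi(F,w)$. For $c_1,\dots,c_j$ put $$\mathfrak P(Y)=\prod_{u\ \text{final}}\bigl(Y^2-w(u)\,c_{\alpha}^{2^{d_\alpha-k}}\bigr)\ \prod_{u}\bigl(Y+w(u')\,c_\alpha^{2^{d_\alpha-k-1}}\bigr),$$ where the first product is over final nodes $u$ of $F$, the second over nodes $u$ of $F$ that are neither final nor ramification nodes ($u'$ denotes the only child of $u$), and in each factor $\alpha$ is the index of the tree $T_\alpha$ containing $u$ and $k$ is the depth of $u$. This is a monic polynomial in $Y$ of degree $m=i+j$; write $\mathfrak P(Y)=\sum_{\kappa=0}^m\lambda_\kappa(c_1,\dots,c_j)Y^\kappa$. On the affine part, $\varphi(F,w)((c_1:1),\dots,(c_j:1))=(\lambda_0(c_1,\dots,c_j):\dots:\lambda_m(c_1,\dots,c_j))$; it is extended to $(\mathbb P^1)^j$, with coordinates $(c_\alpha:c'_\alpha)$, by homogenizing all $\lambda_\kappa$ separately in each pair $(c_\alpha,c_\alpha')$ to the maximal degree of $c_\alpha$ occurring among $\lambda_0,\dots,\lambda_m$. *)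

theory Defs
  imports
    "HOL-Computational_Algebra.Polynomial"
    "HOL-Library.Poly_Mapping"
    "HOL-Library.FuncSet"
    "Jordan_Normal_Form.Determinant"
begin

section \<open>Polynomials in several variables\<close>

text \<open>
  A polynomial in the variables \<open>x\<^sub>0, x\<^sub>1, \<dots>\<close> over \<open>'r\<close> is a finitely supported map from
  monomials (finitely supported exponent vectors) to coefficients, with the convolution product
  of \<^theory>\<open>HOL-Library.Poly_Mapping\<close>.
\<close>

type_synonym 'r mpolynomial = "(nat \<Rightarrow>\<^sub>0 nat) \<Rightarrow>\<^sub>0 'r"

definition mvar :: "nat \<Rightarrow> 'r::comm_ring_1 mpolynomial"
  where "mvar \<kappa> = Poly_Mapping.single (Poly_Mapping.single \<kappa> 1) 1"

definition mconst :: "'r::comm_ring_1 \<Rightarrow> 'r mpolynomial"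
  where "mconst r = Poly_Mapping.single 0 r"

definition eval_int :: "int mpolynomial \<Rightarrow> (nat \<Rightarrow> complex) \<Rightarrow> complex"
  where "eval_int p x =
    (\<Sum>e\<in>Poly_Mapping.keys p. of_int (Poly_Mapping.lookup p e) *
       (\<Prod>\<kappa>\<in>Poly_Mapping.keys e. x \<kappa> ^ Poly_Mapping.lookup e \<kappa>))"

section \<open>Complex projective space\<close>

definition homvecs :: "nat \<Rightarrow> complex vec set"
  where "homvecs n = carrier_vec (n + 1) - {0\<^sub>v (n + 1)}"

definition proj_rel :: "nat \<Rightarrow> (complex vec \<times> complex vec) set"
  where "proj_rel n =
    {(x, y). x \<in> homvecs n \<and> y \<in> homvecs n \<and> (\<exists>s. s \<noteq> 0 \<and> y = s \<cdot>\<^sub>v x)}"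

definition projspace :: "nat \<Rightarrow> complex vec set set"
  where "projspace n = homvecs n // proj_rel n"

section \<open>The variety \<open>X(m,i)\<close>\<close>

text \<open>
  Row and column indices \<open>\<alpha>, \<beta>\<close> run from 1 to \<open>m - 1\<close>; library matrices are indexed from 0.
\<close>

definition frakM :: "nat \<Rightarrow> (nat \<Rightarrow> 'r::comm_ring_1) \<Rightarrow> 'r mat"
  where "frakM m a = mat (m - 1) (m - 1) (\<lambda>(r, s).
    let \<alpha> = r + 1; \<beta> = s + 1
    in if \<alpha> \<le> 2 * \<beta> \<and> 2 * \<beta> - \<alpha> \<le> m then a (2 * \<beta> - \<alpha>) else 0)"

text \<open>\<open>D(m,\<iota>) \<in> \<int>[a\<^sub>0,\<dots>,a\<^sub>m]\<close>; the polynomial variable \<open>U\<close> is \<open>[:0, 1:]\<close>.\<close>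

definition Dpoly :: "nat \<Rightarrow> nat \<Rightarrow> int mpolynomial"
  where "Dpoly m \<iota> =
    coeff (det (map_mat (\<lambda>p. [:p:]) (frakM m mvar) - [:0, 1:] \<cdot>\<^sub>m 1\<^sub>m (m - 1))) \<iota>"

definition Xvar :: "nat \<Rightarrow> nat \<Rightarrow> complex vec set set"
  where "Xvar m i =
    {p \<in> projspace m. \<forall>x\<in>p. \<forall>\<iota><i. eval_int (Dpoly m \<iota>) (\<lambda>\<kappa>. x $ \<kappa>) = 0}"

section \<open>Trees, forests and weights\<close>

text \<open>Edges are directed from parent to child.\<close>

record 'v rooted_tree =
  nodes :: "'v set"
  root_node :: 'v
  edges :: "('v \<times> 'v) set"

definition children :: "'v rooted_tree \<Rightarrow> 'v \<Rightarrow> 'v set"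
  where "children T x = edges T `` {x}"

definition is_tree :: "'v rooted_tree \<Rightarrow> bool"
  where "is_tree T \<longleftrightarrow>
     finite (nodes T) \<and> root_node T \<in> nodes T \<and> edges T \<subseteq> nodes T \<times> nodes T \<and>
     (\<forall>y. (y, root_node T) \<notin> edges T) \<and>
     (\<forall>x\<in>nodes T. x \<noteq> root_node T \<longrightarrow> (\<exists>!y. (y, x) \<in> edges T)) \<and>
     (\<forall>x\<in>nodes T. (root_node T, x) \<in> (edges T)\<^sup>*) \<and>
     (\<forall>x\<in>nodes T. card (children T x) \<le> 2)"

definition final :: "'v rooted_tree \<Rightarrow> 'v \<Rightarrow> bool"
  where "final T x \<longleftrightarrow> children T x = {}"

definition ramification :: "'v rooted_tree \<Rightarrow> 'v \<Rightarrow> bool"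
  where "ramification T x \<longleftrightarrow> card (children T x) = 2"

definition node_depth :: "'v rooted_tree \<Rightarrow> 'v \<Rightarrow> nat"
  where "node_depth T x = (LEAST n. (root_node T, x) \<in> edges T ^^ n)"

definition tree_depth :: "'v rooted_tree \<Rightarrow> nat"
  where "tree_depth T = Max (node_depth T ` nodes T)"

definition is_weight :: "'v rooted_tree \<Rightarrow> ('v \<Rightarrow> complex) \<Rightarrow> bool"
  where "is_weight T w \<longleftrightarrow>
     (\<forall>x\<in>nodes T. w x ^ (2 ^ tree_depth T) = 1) \<and>
     w (root_node T) = 1 \<and>
     (\<forall>(y, x)\<in>edges T. w y = w x ^ 2) \<and>
     (\<forall>y\<in>nodes T. ramification T y \<longrightarrow>
        (\<forall>x1\<in>children T y. \<forall>x2\<in>children T y. x1 \<noteq> x2 \<longrightarrow> w x2 = - w x1))"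

text \<open>
  A forest with \<open>j\<close> trees is given by \<open>T 0, \<dots>, T (j - 1)\<close>. Its nodes are pairs of a tree index
  and a node of that tree, so that the union is disjoint.
\<close>

definition is_forest :: "nat \<Rightarrow> (nat \<Rightarrow> 'v rooted_tree) \<Rightarrow> bool"
  where "is_forest j T \<longleftrightarrow> (\<forall>\<alpha><j. is_tree (T \<alpha>))"

definition forest_nodes :: "nat \<Rightarrow> (nat \<Rightarrow> 'v rooted_tree) \<Rightarrow> (nat \<times> 'v) set"
  where "forest_nodes j T = (SIGMA \<alpha>:{..<j}. nodes (T \<alpha>))"

definition is_forest_weight ::
    "nat \<Rightarrow> (nat \<Rightarrow> 'v rooted_tree) \<Rightarrow> (nat \<Rightarrow> 'v \<Rightarrow> complex) \<Rightarrow> bool"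
  where "is_forest_weight j T w \<longleftrightarrow> (\<forall>\<alpha><j. is_weight (T \<alpha>) (w \<alpha>))"

section \<open>The map \<open>\<phi>(F,w)\<close>\<close>

text \<open>
  The polynomial in \<open>Y\<close> over \<open>\<complex>[c\<^sub>0,\<dots>,c\<^bsub>j-1\<^esub>]\<close>, where \<open>c\<^sub>\<alpha>\<close> is \<^term>\<open>mvar \<alpha>\<close>.
\<close>

definition frakP ::
    "nat \<Rightarrow> (nat \<Rightarrow> 'v rooted_tree) \<Rightarrow> (nat \<Rightarrow> 'v \<Rightarrow> complex) \<Rightarrow> complex mpolynomial poly"
  where "frakP j T w =
    (\<Prod>(\<alpha>, u)\<in>{(\<alpha>, u)\<in>forest_nodes j T. final (T \<alpha>) u}.
       [:0, 1:] ^ 2 -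
       [: mconst (w \<alpha> u) * mvar \<alpha> ^ (2 ^ (tree_depth (T \<alpha>) - node_depth (T \<alpha>) u)) :]) *
    (\<Prod>(\<alpha>, u)\<in>{(\<alpha>, u)\<in>forest_nodes j T. \<not> final (T \<alpha>) u \<and> \<not> ramification (T \<alpha>) u}.
       [:0, 1:] +
       [: mconst (w \<alpha> (the_elem (children (T \<alpha>) u))) *
          mvar \<alpha> ^ (2 ^ (tree_depth (T \<alpha>) - node_depth (T \<alpha>) u - 1)) :])"

definition lam ::
    "nat \<Rightarrow> (nat \<Rightarrow> 'v rooted_tree) \<Rightarrow> (nat \<Rightarrow> 'v \<Rightarrow> complex) \<Rightarrow> nat \<Rightarrow> complex mpolynomial"
  where "lam j T w \<kappa> = coeff (frakP j T w) \<kappa>"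

definition target_dim :: "nat \<Rightarrow> (nat \<Rightarrow> 'v rooted_tree) \<Rightarrow> nat"
  where "target_dim j T = card (forest_nodes j T) + j"

text \<open>The maximal degree of \<open>c\<^sub>\<alpha>\<close> occurring among \<open>\<lambda>\<^sub>0, \<dots>, \<lambda>\<^sub>m\<close>.\<close>

definition max_deg ::
    "nat \<Rightarrow> (nat \<Rightarrow> 'v rooted_tree) \<Rightarrow> (nat \<Rightarrow> 'v \<Rightarrow> complex) \<Rightarrow> nat \<Rightarrow> nat"
  where "max_deg j T w \<alpha> =
    Max ((\<lambda>e. Poly_Mapping.lookup e \<alpha>) `
         (\<Union>\<kappa>\<in>{0..target_dim j T}. Poly_Mapping.keys (lam j T w \<kappa>)))"

text \<open>
  \<open>hom_eval j n p v\<close> homogenizes \<open>p\<close> to degree \<open>n \<alpha>\<close> in each pair \<open>(c\<^sub>\<alpha>, c'\<^sub>\<alpha>)\<close> and evaluates the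
  result at \<open>(c\<^sub>\<alpha>, c'\<^sub>\<alpha>) = (v \<alpha> $ 0, v \<alpha> $ 1)\<close>.
\<close>

definition hom_eval ::
    "nat \<Rightarrow> (nat \<Rightarrow> nat) \<Rightarrow> complex mpolynomial \<Rightarrow> (nat \<Rightarrow> complex vec) \<Rightarrow> complex"
  where "hom_eval j n p v =
    (\<Sum>e\<in>Poly_Mapping.keys p. Poly_Mapping.lookup p e *
       (\<Prod>\<alpha><j. (v \<alpha> $ 0) ^ Poly_Mapping.lookup e \<alpha> *
                (v \<alpha> $ 1) ^ (n \<alpha> - Poly_Mapping.lookup e \<alpha>)))"

definition phi_vec ::
    "nat \<Rightarrow> (nat \<Rightarrow> 'v rooted_tree) \<Rightarrow> (nat \<Rightarrow> 'v \<Rightarrow> complex) \<Rightarrow> (nat \<Rightarrow> complex vec) \<Rightarrow> complex vec"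
  where "phi_vec j T w v =
    vec (target_dim j T + 1) (\<lambda>\<kappa>. hom_eval j (max_deg j T w) (lam j T w \<kappa>) v)"

definition proj_line_power :: "nat \<Rightarrow> (nat \<Rightarrow> complex vec set) set"
  where "proj_line_power j = (\<Pi>\<^sub>E \<alpha>\<in>{..<j}. projspace 1)"

text \<open>
  As usual for functions on quotients, \<open>\<phi>\<close> is the union of the classes obtained from all choices
  of homogeneous coordinates. The union is a point only if these classes agree (and only if not
  all coordinates vanish: \<open>proj_rel m `` {0}\<close> is empty).
\<close>

definition phi ::
    "nat \<Rightarrow> (nat \<Rightarrow> 'v rooted_tree) \<Rightarrow> (nat \<Rightarrow> 'v \<Rightarrow> complex) \<Rightarrow>
     (nat \<Rightarrow> complex vec set) \<Rightarrow> complex vec set"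
  where "phi j T w p =
    (\<Union>v\<in>{v. \<forall>\<alpha><j. v \<alpha> \<in> p \<alpha>}. proj_rel (target_dim j T) `` {phi_vec j T w v})"

end

theory Submission
  imports Defs "Jordan_Normal_Form.Char_Poly"
begin

text \<open>
  Let \<open>P\<close> be the polynomial with coefficients \<open>a\<^sub>\<kappa>\<close>, and for a complex number \<open>z\<close> let \<open>e(z)\<close> be
  the column \<open>(z, z\<^sup>2, \<dots>, z\<^bsup>m-1\<^esup>)\<close>. Collecting the even part of \<open>Y\<^sup>\<alpha> P(Y)\<close> gives
  \<open>M e(y\<^sup>2) = (P(y) e(y) + P(-y) e(-y)) / 2\<close>. Attach to a node \<open>u\<close> of depth \<open>k\<close> in the tree
  \<open>T\<^sub>\<alpha>\<close> the value \<open>z\<^sub>u = w(u) c\<^sub>\<alpha> ^ (2 ^ (d\<^sub>\<alpha> - k))\<close>, so that the value of a parent is the square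
  of the value of a child. The factors of the polynomial of the forest are made so that \<open>M\<close> sends
  \<open>e(z\<^sub>u)\<close> to a combination of the \<open>e(z\<^sub>x)\<close> with \<open>x\<close> a child of \<open>u\<close>. If the \<open>z\<^sub>u\<close> are distinct and
  nonzero, the \<open>e(z\<^sub>u)\<close> are therefore a basis of an \<open>i\<close>-dimensional subspace on which \<open>M\<close> is
  nilpotent, and \<open>U\<^sup>i\<close> divides the characteristic polynomial. The remaining points follow because
  every point lies on a polynomial curve that meets the exceptional set only finitely often.

  The map is well defined because homogenization is multiplicative: the homogenized polynomial
  is the product of the homogenized factors, none of which vanishes, and its degree in \<open>Y\<close> is at
  most \<open>m\<close> since a binary tree has one more final node than ramification nodes.
\<close>

section \<open>Determinants with a nilpotent block\<close>

text \<open>A kernel vector of the transpose is the coefficient vector of a polynomial of degree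
  below \<open>n\<close> with the \<open>n\<close> distinct zeros \<open>z u\<close>. The exponents
  start at 1, so each evaluation carries an extra factor \<open>z u\<close> to be cancelled.\<close>

lemma det_vandermonde_nonzero:
  fixes z :: "nat \<Rightarrow> 'a::idom"
  assumes inj: "inj_on z {..<n}" and nz: "\<And>u. u < n \<Longrightarrow> z u \<noteq> 0"
  shows "det (mat n n (\<lambda>(r, u). z u ^ Suc r)) \<noteq> 0"
proof
  let ?V = "mat n n (\<lambda>(r, u). z u ^ Suc r)"
  assume "det ?V = 0"
  then have "det (transpose_mat ?V) = 0"
    by (subst det_transpose[of _ n]) auto
  then obtain v where v: "v \<in> carrier_vec n" "v \<noteq> 0\<^sub>v n"
    and ker: "transpose_mat ?V *\<^sub>v v = 0\<^sub>v n"
    using det_0_iff_vec_prod_zero[of "transpose_mat ?V" n] by auto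
  define p where "p = (\<Sum>r<n. monom (v $ r) r)"
  have coeff_p: "coeff p r = (if r < n then v $ r else 0)" for r
    by (simp add: p_def coeff_sum)
  have root: "poly p (z u) = 0" if "u < n" for u
  proof -
    have "(transpose_mat ?V *\<^sub>v v) $ u = (\<Sum>r<n. z u ^ Suc r * v $ r)"
      using that v(1) by (simp add: scalar_prod_def atLeast0LessThan)
    also have "\<dots> = z u * poly p (z u)"
      by (simp add: p_def poly_sum poly_monom sum_distrib_left mult_ac)
    finally have "z u * poly p (z u) = 0" using that by (simp only: ker index_zero_vec)
    then show ?thesis using nz[OF that] by simp
  qed
  have "p = 0"
  proof (rule ccontr)
    assume "p \<noteq> 0"
    then have "n > 0" by (auto simp: p_def intro: gr0I)
    have "degree p \<le> n - 1"
      by (rule degree_le) (auto simp: coeff_p)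
    moreover have "card (z ` {..<n}) \<le> card {x. poly p x = 0}"
      by (rule card_mono[OF poly_roots_finite[OF \<open>p \<noteq> 0\<close>]]) (auto simp: root)
    moreover have "card {x. poly p x = 0} \<le> degree p"
      by (rule card_poly_roots_bound[OF \<open>p \<noteq> 0\<close>])
    ultimately show False using \<open>n > 0\<close> by (simp add: card_image[OF inj])
  qed
  then have "v $ r = 0" if "r < n" for r
    using coeff_p[of r] that by simp
  then show False using v by (auto intro: eq_vecI)
qed

text \<open>The first \<open>k\<close> columns of \<open>E\<close> span a subspace on which
  \<open>M\<close> acts strictly triangularly. So \<open>(M - X) E\<close> factors as
  \<open>V T\<close> with \<open>T\<close> triangular and \<open>k\<close> diagonal entries of
  \<open>T\<close> equal to \<open>- X\<close>. Comparing determinants, \<open>X ^ k\<close> divides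
  \<open>det A\<close> times the nonzero constant \<open>det E\<close>.\<close>

lemma coeff_det_zero_if_nilpotent_block:
  fixes M E :: "'a::idom mat"
  assumes M: "M \<in> carrier_mat n n" and E: "E \<in> carrier_mat n n"
    and detE: "det E \<noteq> 0" and "k \<le> n"
    and rel: "\<And>r u. r < n \<Longrightarrow> u < k \<Longrightarrow>
      (\<Sum>s<n. M $$ (r, s) * E $$ (s, u)) = (\<Sum>u'<u. N u' u * E $$ (r, u'))"
    and "\<iota> < k"
  shows "coeff (det (map_mat (\<lambda>p. [:p:]) M - [:0, 1:] \<cdot>\<^sub>m 1\<^sub>m n)) \<iota> = 0"
proof -
  let ?C = "\<lambda>p::'a. [:p:]" and ?X = "[:0, 1:] :: 'a poly"
  interpret C: comm_ring_hom ?C by unfold_locales (auto simp: one_pCons)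
  define A where "A = map_mat ?C M - ?X \<cdot>\<^sub>m 1\<^sub>m n"
  define B where "B = A * map_mat ?C E"
  \<comment> \<open>\<open>V\<close> keeps the first \<open>k\<close> columns of \<open>E\<close>
    and takes the others from \<open>B\<close>; \<open>T\<close> holds the action of
    \<open>M - X\<close> on the former and the identity on the rest.\<close>
  define V where "V = mat n n (\<lambda>(r, u). if u < k then [:E $$ (r, u):] else B $$ (r, u))"
  define T where "T = mat n n (\<lambda>(u', u).
    if u < k then (if u' < u then [:N u' u:] else if u' = u then - ?X else 0)
    else (if u' = u then 1 else 0))"
  have car: "A \<in> carrier_mat n n" "B \<in> carrier_mat n n" "V \<in> carrier_mat n n" "T \<in> carrier_mat n n"
    using M E by (auto simp: A_def B_def V_def T_def)
  have B_low: "B $$ (r, u) = (\<Sum>u'<u. [:N u' u:] * [:E $$ (r, u'):]) - ?X * [:E $$ (r, u):]"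
    if "r < n" "u < k" for r u
  proof -
    have "B $$ (r, u) = (\<Sum>s<n. A $$ (r, s) * [:E $$ (s, u):])"
      using that \<open>k \<le> n\<close> E car(1)
      by (simp add: B_def scalar_prod_def atLeast0LessThan)
    also have "\<dots> = (\<Sum>s<n. [:M $$ (r, s) * E $$ (s, u):] - (if s = r then ?X * [:E $$ (r, u):] else 0))"
      using that M by (intro sum.cong) (auto simp: A_def algebra_simps)
    also have "\<dots> = [:\<Sum>s<n. M $$ (r, s) * E $$ (s, u):] - ?X * [:E $$ (r, u):]"
      using that by (simp add: sum_subtractf C.hom_sum)
    also have "[:\<Sum>s<n. M $$ (r, s) * E $$ (s, u):] = (\<Sum>u'<u. [:N u' u:] * [:E $$ (r, u'):])"
      unfolding rel[OF that] by (simp add: C.hom_sum mult.commute)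
    finally show ?thesis .
  qed
  have "B = V * T"
  proof (rule eq_matI)
    fix r u assume "r < dim_row (V * T)" "u < dim_col (V * T)"
    then have ru: "r < n" "u < n" using car by auto
    have VT: "(V * T) $$ (r, u) = (\<Sum>s<n. V $$ (r, s) * T $$ (s, u))"
      using ru car by (simp add: scalar_prod_def atLeast0LessThan)
    show "B $$ (r, u) = (V * T) $$ (r, u)"
    proof (cases "u < k")
      case True
      have "(V * T) $$ (r, u) = (\<Sum>s\<in>insert u {..<u}. V $$ (r, s) * T $$ (s, u))"
        unfolding VT using ru True by (intro sum.mono_neutral_right) (auto simp: T_def)
      also have "\<dots> = - ?X * [:E $$ (r, u):] + (\<Sum>s<u. [:E $$ (r, s):] * [:N s u:])"
        using ru True by (simp add: T_def V_def)
      finally show ?thesis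
        by (simp add: B_low[OF ru(1) True] mult.commute)
    next
      case False
      have "(V * T) $$ (r, u) = (\<Sum>s\<in>{u}. V $$ (r, s) * T $$ (s, u))"
        unfolding VT using ru False by (intro sum.mono_neutral_right) (auto simp: T_def)
      then show ?thesis using ru False by (simp add: T_def V_def)
    qed
  qed (use car in auto)
  then have "det A * [:det E:] = det V * det T"
    using det_mult[OF car(1), of "map_mat ?C E"] det_mult[OF car(3,4)] E
    by (simp add: B_def C.hom_det)
  also have "det T = (\<Prod>u<n. if u < k then - ?X else 1)"
    by (subst det_upper_triangular[OF _ car(4)])
       (auto simp: T_def upper_triangular_def prod_list_diag_prod atLeast0LessThan intro!: prod.cong)
  also have "\<dots> = (- ?X) ^ k"
  proof -
    have "(\<Prod>u<n. if u < k then - ?X else 1) = (\<Prod>u<k. - ?X)"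
      using \<open>k \<le> n\<close> by (intro prod.mono_neutral_cong_right) auto
    then show ?thesis by simp
  qed
  also have "\<dots> = smult ((-1) ^ k) (monom 1 k)"
    by (induction k) (auto simp: monom_Suc)
  finally have "smult (det E) (det A) = smult ((-1) ^ k) (monom 1 k * det V)"
    by (simp add: mult.commute)
  then have "det E * coeff (det A) \<iota> = (-1) ^ k * coeff (monom 1 k * det V) \<iota>"
    by (metis coeff_smult)
  also have "coeff (monom 1 k * det V) \<iota> = 0"
    using \<open>\<iota> < k\<close> by (simp add: coeff_monom_mult)
  finally show ?thesis using detE by (simp add: A_def)
qed

section \<open>The matrix acting on columns of powers\<close>

lemma sum_even_odd: "(\<Sum>k<2 * m. f k) = (\<Sum>b<m. f (2 * b) + f (2 * b + 1))"
  for f :: "nat \<Rightarrow> 'a::comm_monoid_add"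
  by (induction m) (auto simp: add_ac)

text \<open>Row \<open>r\<close> of the matrix lists even coefficients of \<open>Q\<close>, which is
  \<open>P\<close> times the power \<open>Suc r\<close> of the variable. Averaging \<open>Q\<close>
  over \<open>y\<close> and \<open>- y\<close> keeps exactly the even part.\<close>

lemma frakM_mult_power:
  fixes P :: "complex poly"
  assumes deg: "degree P \<le> m" and r: "r < m - 1"
  shows "(\<Sum>s<m - 1. frakM m (coeff P) $$ (r, s) * (y\<^sup>2) ^ Suc s) =
    (poly P y * y ^ Suc r + poly P (- y) * (- y) ^ Suc r) / 2"
proof -
  define Q where "Q = monom 1 (Suc r) * P"
  have Q: "coeff Q k = (if Suc r \<le> k then coeff P (k - Suc r) else 0)" for k
    by (simp add: Q_def coeff_monom_mult)
  have degQ: "degree Q < 2 * m"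
  proof -
    have "degree Q \<le> Suc r + degree P"
      unfolding Q_def by (rule order.trans[OF degree_mult_le]) (simp add: degree_monom_eq)
    then show ?thesis using deg r by linarith
  qed
  have poly_Q: "poly Q x = (\<Sum>k<2 * m. coeff Q k * x ^ k)" for x
    unfolding poly_altdef using degQ
    by (intro sum.mono_neutral_left) (auto simp: coeff_eq_0)
  have "poly Q y + poly Q (- y) = (\<Sum>b<m. 2 * (coeff Q (2 * b) * (y\<^sup>2) ^ b))"
    unfolding poly_Q sum.distrib[symmetric]
    by (subst sum_even_odd) (simp add: power_mult)
  \<comment> \<open>\<open>Q\<close> has no constant term, so the summand \<open>b = 0\<close> drops
    out and \<open>b = Suc s\<close> runs through the columns.\<close>
  also have "\<dots> = 2 * (\<Sum>s<m - 1. coeff Q (2 * Suc s) * (y\<^sup>2) ^ Suc s)"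
  proof -
    have "m = Suc (m - 1)" using r by simp
    then have "(\<Sum>b<m. 2 * (coeff Q (2 * b) * (y\<^sup>2) ^ b)) =
        (\<Sum>b<Suc (m - 1). 2 * (coeff Q (2 * b) * (y\<^sup>2) ^ b))" by simp
    also have "\<dots> = 2 * (\<Sum>s<m - 1. coeff Q (2 * Suc s) * (y\<^sup>2) ^ Suc s)"
      unfolding sum.lessThan_Suc_shift by (simp add: Q sum_distrib_left)
    finally show ?thesis .
  qed
  finally have "(\<Sum>s<m - 1. coeff Q (2 * Suc s) * (y\<^sup>2) ^ Suc s) = (poly Q y + poly Q (- y)) / 2"
    by simp
  moreover have "frakM m (coeff P) $$ (r, s) = coeff Q (2 * Suc s)" if "s < m - 1" for s
    using that r deg by (auto simp: frakM_def Let_def Q coeff_eq_0)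
  ultimately show ?thesis
    by (simp add: Q_def poly_monom mult.commute)
qed

text \<open>Supplies the missing points when \<open>k\<close> columns of powers are completed to an
  invertible square matrix; only finitely many numbers have to be avoided.\<close>

lemma ex_inj_extension:
  fixes z :: "nat \<Rightarrow> complex"
  assumes "inj_on z {..<k}" "\<And>u. u < k \<Longrightarrow> z u \<noteq> 0" "k \<le> n"
  obtains z' where "inj_on z' {..<n}" "\<And>u. u < n \<Longrightarrow> z' u \<noteq> 0" "\<And>u. u < k \<Longrightarrow> z' u = z u"
proof -
  define F where "F = z ` {..<k} \<union> {0}"
  have "infinite (UNIV - F)"
    unfolding F_def by (rule Diff_infinite_finite) (auto simp: infinite_UNIV_char_0)
  then obtain g :: "nat \<Rightarrow> complex" where g: "inj g" "range g \<subseteq> UNIV - F"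
    using infinite_countable_subset by blast
  define z' where "z' = (\<lambda>u. if u < k then z u else g u)"
  have gz: "g u \<noteq> z v" if "v < k" for u v
    using g(2) that unfolding F_def by (auto simp: image_subset_iff)
  have g0: "g u \<noteq> 0" for u
    using g(2) unfolding F_def by (auto simp: image_subset_iff)
  show thesis
  proof (rule that)
    show "inj_on z' {..<n}"
      using assms(1) g(1) gz gz[symmetric] unfolding z'_def
      by (auto simp: inj_on_def split: if_splits)
    show "z' u \<noteq> 0" for u using assms(2) g0 by (auto simp: z'_def)
  qed (simp add: z'_def)
qed

text \<open>A square root \<open>x\<close> of \<open>z u\<close> contributes its column of powers
  multiplied by \<open>poly P x\<close>. This is either zero or a multiple of an earlier column, so
  the matrix is strictly triangular on the first \<open>k\<close> columns.\<close>

lemma coeff_det_frakM_zero: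
  fixes P :: "complex poly" and z :: "nat \<Rightarrow> complex"
  assumes deg: "degree P \<le> m" and k: "k \<le> m - 1"
    and inj: "inj_on z {..<k}" and nz: "\<And>u. u < k \<Longrightarrow> z u \<noteq> 0"
    and step: "\<And>u. u < k \<Longrightarrow> \<exists>y. y\<^sup>2 = z u \<and>
      (\<forall>x\<in>{y, - y}. poly P x = 0 \<or> (\<exists>u'<u. z u' = x))"
    and "\<iota> < k"
  shows "coeff (det (map_mat (\<lambda>p. [:p:]) (frakM m (coeff P)) - [:0, 1:] \<cdot>\<^sub>m 1\<^sub>m (m - 1))) \<iota> = 0"
proof -
  obtain z' where z': "inj_on z' {..<m - 1}" "\<And>u. u < m - 1 \<Longrightarrow> z' u \<noteq> 0"
    "\<And>u. u < k \<Longrightarrow> z' u = z u"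
    using ex_inj_extension[OF inj nz k] by blast
  define E where "E = mat (m - 1) (m - 1) (\<lambda>(r, u). z' u ^ Suc r)"
  \<comment> \<open>The coefficients must not depend on the row \<open>r\<close>: they are all zero
    if \<open>P\<close> vanishes at \<open>x\<close>, and otherwise concentrated at the index of
    \<open>x\<close>.\<close>
  have evaluation: "\<exists>c. \<forall>r. poly P x * x ^ Suc r = (\<Sum>u'<u. c u' * z u' ^ Suc r)"
    if x: "poly P x = 0 \<or> (\<exists>u'<u. z u' = x)" for x u
    using x
  proof
    assume "poly P x = 0"
    then show ?thesis by (intro exI[of _ "\<lambda>_. 0"]) simp
  next
    assume "\<exists>u'<u. z u' = x"
    then obtain u' where u': "u' < u" "z u' = x" by blast
    have "(\<Sum>v<u. (if v = u' then poly P x else 0) * z v ^ Suc r) = poly P x * x ^ Suc r" for r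
    proof -
      have "(\<Sum>v<u. (if v = u' then poly P x else 0) * z v ^ Suc r) =
        (\<Sum>v<u. if v = u' then poly P x * z v ^ Suc r else 0)"
        by (intro sum.cong) auto
      then show ?thesis using u' by simp
    qed
    then show ?thesis by (intro exI[of _ "\<lambda>v. if v = u' then poly P x else 0"]) simp
  qed
  have "\<exists>c. \<forall>r<m - 1. (\<Sum>s<m - 1. frakM m (coeff P) $$ (r, s) * E $$ (s, u)) =
      (\<Sum>u'<u. c u' * E $$ (r, u'))" if u: "u < k" for u
  proof -
    obtain y where y: "y\<^sup>2 = z u" "\<forall>x\<in>{y, - y}. poly P x = 0 \<or> (\<exists>u'<u. z u' = x)"
      using step[OF u] by blast
    then obtain c1 c2 where
      c1: "\<And>r. poly P y * y ^ Suc r = (\<Sum>u'<u. c1 u' * z u' ^ Suc r)" and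
      c2: "\<And>r. poly P (- y) * (- y) ^ Suc r = (\<Sum>u'<u. c2 u' * z u' ^ Suc r)"
      using evaluation[of y u] evaluation[of "- y" u] by blast
    have "(\<Sum>s<m - 1. frakM m (coeff P) $$ (r, s) * E $$ (s, u)) =
      (\<Sum>u'<u. (c1 u' + c2 u') / 2 * E $$ (r, u'))" if r: "r < m - 1" for r
    proof -
      have "(\<Sum>s<m - 1. frakM m (coeff P) $$ (r, s) * E $$ (s, u)) =
        (\<Sum>s<m - 1. frakM m (coeff P) $$ (r, s) * (y\<^sup>2) ^ Suc s)"
        using u k by (intro sum.cong) (auto simp: E_def y z')
      also have "\<dots> = ((\<Sum>u'<u. c1 u' * z u' ^ Suc r) + (\<Sum>u'<u. c2 u' * z u' ^ Suc r)) / 2"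
        unfolding frakM_mult_power[OF deg r] c1 c2 ..
      also have "\<dots> = (\<Sum>u'<u. (c1 u' + c2 u') / 2 * z u' ^ Suc r)"
        by (simp add: sum.distrib[symmetric] sum_divide_distrib add_divide_distrib distrib_right)
      also have "\<dots> = (\<Sum>u'<u. (c1 u' + c2 u') / 2 * E $$ (r, u'))"
        using u k r by (intro sum.cong) (auto simp: E_def z')
      finally show ?thesis .
    qed
    then show ?thesis by (intro exI[of _ "\<lambda>u'. (c1 u' + c2 u') / 2"]) blast
  qed
  \<comment> \<open>The range condition moves below the existential quantifier, so that choice
    yields one family of coefficients for all columns.\<close>
  then have "\<forall>u. \<exists>c. u < k \<longrightarrow> (\<forall>r<m - 1.
      (\<Sum>s<m - 1. frakM m (coeff P) $$ (r, s) * E $$ (s, u)) = (\<Sum>u'<u. c u' * E $$ (r, u')))"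
    by blast
  from choice[OF this] obtain c where c: "\<forall>u. u < k \<longrightarrow> (\<forall>r<m - 1.
      (\<Sum>s<m - 1. frakM m (coeff P) $$ (r, s) * E $$ (s, u)) = (\<Sum>u'<u. c u u' * E $$ (r, u')))" ..
  have "det E \<noteq> 0"
    unfolding E_def by (rule det_vandermonde_nonzero[OF z'(1,2)])
  moreover have "frakM m (coeff P) \<in> carrier_mat (m - 1) (m - 1)" "E \<in> carrier_mat (m - 1) (m - 1)"
    by (auto simp: frakM_def E_def)
  ultimately show ?thesis
    using c \<open>\<iota> < k\<close> k
    by (intro coeff_det_zero_if_nilpotent_block[where E = E and N = "\<lambda>u' u. c u u'" and k = k]) blast+
qed

section \<open>Evaluation of polynomials in several variables\<close>

text \<open>The common shape of \<^const>\<open>eval_int\<close> and \<^const>\<open>hom_eval\<close>.\<close>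

definition psum :: "('k \<Rightarrow> 'r::zero \<Rightarrow> 's::comm_monoid_add) \<Rightarrow> ('k \<Rightarrow>\<^sub>0 'r) \<Rightarrow> 's"
  where "psum f p = (\<Sum>e\<in>Poly_Mapping.keys p. f e (Poly_Mapping.lookup p e))"

lemma psum_superset:
  assumes "finite A" "Poly_Mapping.keys p \<subseteq> A" "\<And>e. f e 0 = 0"
  shows "psum f p = (\<Sum>e\<in>A. f e (Poly_Mapping.lookup p e))"
  unfolding psum_def using assms
  by (intro sum.mono_neutral_left) (auto simp: in_keys_iff)

lemma psum_add:
  assumes "\<And>e. f e 0 = 0" "\<And>e a b. f e (a + b) = f e a + f e b"
  shows "psum f (p + q) = psum f p + psum f q"
proof -
  let ?A = "Poly_Mapping.keys p \<union> Poly_Mapping.keys q"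
  have "psum f r = (\<Sum>e\<in>?A. f e (Poly_Mapping.lookup r e))"
    if "Poly_Mapping.keys r \<subseteq> ?A" for r
    using that by (intro psum_superset) (auto simp: assms)
  then show ?thesis
    using keys_add[of p q] by (simp add: lookup_add assms sum.distrib)
qed

lemma psum_sum:
  assumes "\<And>e. f e 0 = 0" "\<And>e a b. f e (a + b) = f e a + f e b"
  shows "psum f (\<Sum>i\<in>I. p i) = (\<Sum>i\<in>I. psum f (p i))"
proof -
  have "psum f 0 = 0" by (simp add: psum_def)
  then show ?thesis
    by (induction I rule: infinite_finite_induct) (auto simp: psum_add[of f, OF assms])
qed

lemma psum_single: "f e 0 = 0 \<Longrightarrow> psum f (Poly_Mapping.single e r) = f e r"
  by (simp add: psum_def)

lemma poly_mapping_sum_single: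
  "(\<Sum>e\<in>Poly_Mapping.keys p. Poly_Mapping.single e (Poly_Mapping.lookup p e)) = p"
  by (rule poly_mapping_eqI) (auto simp: lookup_sum lookup_single when_def in_keys_iff)

text \<open>Three different summands are allowed because homogenization uses one degree for each
  factor and their sum for the product. The product rule is required on the supports only, where
  degree bounds are available.\<close>

lemma psum_mult:
  fixes p q :: "'k::monoid_add \<Rightarrow>\<^sub>0 'r::semiring_0" and f g h :: "'k \<Rightarrow> 'r \<Rightarrow> 's::semiring_0"
  assumes h: "\<And>e. h e 0 = 0" "\<And>e a b. h e (a + b) = h e a + h e b"
    and mult: "\<And>e e'. e \<in> Poly_Mapping.keys p \<Longrightarrow> e' \<in> Poly_Mapping.keys q \<Longrightarrow>
      h (e + e') (Poly_Mapping.lookup p e * Poly_Mapping.lookup q e') =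
      f e (Poly_Mapping.lookup p e) * g e' (Poly_Mapping.lookup q e')"
  shows "psum h (p * q) = psum f p * psum g q"
proof -
  let ?s = Poly_Mapping.single and ?l = Poly_Mapping.lookup and ?k = Poly_Mapping.keys
  have "p * q = (\<Sum>e\<in>?k p. ?s e (?l p e)) * (\<Sum>e'\<in>?k q. ?s e' (?l q e'))"
    by (simp add: poly_mapping_sum_single)
  also have "\<dots> = (\<Sum>e\<in>?k p. \<Sum>e'\<in>?k q. ?s (e + e') (?l p e * ?l q e'))"
    by (simp add: sum_product mult_single)
  finally have "psum h (p * q) = (\<Sum>e\<in>?k p. \<Sum>e'\<in>?k q. h (e + e') (?l p e * ?l q e'))"
    by (simp add: psum_sum[of h, OF h] psum_single h)
  also have "\<dots> = psum f p * psum g q"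
    by (simp add: mult psum_def sum_product)
  finally show ?thesis .
qed

lemma prod_keys_power_add:
  fixes x :: "nat \<Rightarrow> 'a::comm_semiring_1" and e e' :: "nat \<Rightarrow>\<^sub>0 nat"
  shows "(\<Prod>\<kappa>\<in>Poly_Mapping.keys (e + e'). x \<kappa> ^ Poly_Mapping.lookup (e + e') \<kappa>) =
    (\<Prod>\<kappa>\<in>Poly_Mapping.keys e. x \<kappa> ^ Poly_Mapping.lookup e \<kappa>) *
    (\<Prod>\<kappa>\<in>Poly_Mapping.keys e'. x \<kappa> ^ Poly_Mapping.lookup e' \<kappa>)"
proof -
  let ?A = "Poly_Mapping.keys e \<union> Poly_Mapping.keys e'"
  have "(\<Prod>\<kappa>\<in>Poly_Mapping.keys d. x \<kappa> ^ Poly_Mapping.lookup d \<kappa>) =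
      (\<Prod>\<kappa>\<in>?A. x \<kappa> ^ Poly_Mapping.lookup d \<kappa>)" if "Poly_Mapping.keys d \<subseteq> ?A" for d
    using that by (intro prod.mono_neutral_left) (auto simp: in_keys_iff)
  from this[of e] this[of e'] this[of "e + e'"] show ?thesis
    using keys_add[of e e'] by (simp only: Un_upper1 Un_upper2 lookup_add power_add prod.distrib)
qed

lemma eval_int_psum:
  "eval_int p x = psum (\<lambda>e r. of_int r *
     (\<Prod>\<kappa>\<in>Poly_Mapping.keys e. x \<kappa> ^ Poly_Mapping.lookup e \<kappa>)) p"
  by (simp add: eval_int_def psum_def)

lemma comm_ring_hom_eval_int: "comm_ring_hom (\<lambda>p. eval_int p x)"
proof
  show "eval_int 1 x = 1"
    unfolding eval_int_psum single_one[symmetric] by (subst psum_single) auto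
  show "eval_int (p + q) x = eval_int p x + eval_int q x" for p q
    unfolding eval_int_psum by (rule psum_add) (auto simp: distrib_right)
  show "eval_int (p * q) x = eval_int p x * eval_int q x" for p q
    unfolding eval_int_psum
    by (rule psum_mult) (auto simp: prod_keys_power_add algebra_simps)
qed (simp add: eval_int_def)

lemma eval_int_mvar: "eval_int (mvar \<kappa>) x = x \<kappa>"
  unfolding eval_int_psum mvar_def by (subst psum_single) auto

text \<open>Evaluation is a ring homomorphism, hence commutes with determinants and with taking
  coefficients; what remains concerns a complex matrix.\<close>

lemma eval_int_Dpoly:
  "eval_int (Dpoly m \<iota>) x =
    coeff (det (map_mat (\<lambda>p. [:p:]) (frakM m x) - [:0, 1:] \<cdot>\<^sub>m 1\<^sub>m (m - 1))) \<iota>"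
proof -
  let ?h = "\<lambda>p. eval_int p x"
  interpret h: comm_ring_hom ?h by (rule comm_ring_hom_eval_int)
  interpret hp: map_poly_comm_ring_hom ?h ..
  let ?A = "map_mat (\<lambda>p. [:p:]) (frakM m mvar) - [:0, 1:] \<cdot>\<^sub>m 1\<^sub>m (m - 1)"
  have const: "map_poly ?h [:p:] = [:?h p:]" for p
    by (rule poly_eqI) (simp add: coeff_map_poly coeff_pCons split: nat.split)
  have "eval_int (Dpoly m \<iota>) x = coeff (det (map_mat (map_poly ?h) ?A)) \<iota>"
    by (simp add: Dpoly_def)
  also have "map_mat (map_poly ?h) ?A =
      map_mat (\<lambda>p. [:p:]) (frakM m x) - [:0, 1:] \<cdot>\<^sub>m 1\<^sub>m (m - 1)"
    by (rule eq_matI) (auto simp: frakM_def Let_def eval_int_mvar map_poly_pCons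
        hp.hom_minus hp.hom_uminus const)
  finally show ?thesis .
qed

section \<open>Multiplicativity of homogenization\<close>

text \<open>Guards the truncated subtraction in \<open>hom_eval\<close>: under these bounds the
  complementary exponents add up in products.\<close>

definition exps_le :: "(nat \<Rightarrow> nat) \<Rightarrow> 'r::zero mpolynomial \<Rightarrow> bool"
  where "exps_le n p \<longleftrightarrow> (\<forall>e\<in>Poly_Mapping.keys p. \<forall>\<alpha>. Poly_Mapping.lookup e \<alpha> \<le> n \<alpha>)"

lemma exps_le_mult:
  assumes "exps_le n p" "exps_le n' q"
  shows "exps_le (\<lambda>\<alpha>. n \<alpha> + n' \<alpha>) (p * q)"
  unfolding exps_le_def
proof (intro ballI allI)
  fix e \<alpha> assume "e \<in> Poly_Mapping.keys (p * q)"
  then obtain a b where "e = a + b" "a \<in> Poly_Mapping.keys p" "b \<in> Poly_Mapping.keys q"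
    using keys_mult[of p q] by auto
  then show "Poly_Mapping.lookup e \<alpha> \<le> n \<alpha> + n' \<alpha>"
    using assms by (simp add: exps_le_def lookup_add add_mono)
qed

lemma exps_le_sum:
  assumes "\<And>i. i \<in> I \<Longrightarrow> exps_le n (p i)"
  shows "exps_le n (\<Sum>i\<in>I. p i)"
  unfolding exps_le_def
proof (intro ballI allI)
  fix e \<alpha> assume e: "e \<in> Poly_Mapping.keys (\<Sum>i\<in>I. p i)"
  then have "(\<Sum>i\<in>I. Poly_Mapping.lookup (p i) e) \<noteq> 0"
    by (simp add: in_keys_iff lookup_sum)
  then obtain i where "i \<in> I" "Poly_Mapping.lookup (p i) e \<noteq> 0"
    by (meson sum.not_neutral_contains_not_neutral)
  then show "Poly_Mapping.lookup e \<alpha> \<le> n \<alpha>"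
    using assms by (simp add: exps_le_def in_keys_iff)
qed

lemma hom_eval_psum:
  "hom_eval j n p v = psum (\<lambda>e r. r * (\<Prod>\<alpha><j. (v \<alpha> $ 0) ^ Poly_Mapping.lookup e \<alpha> *
     (v \<alpha> $ 1) ^ (n \<alpha> - Poly_Mapping.lookup e \<alpha>))) p"
  by (simp add: hom_eval_def psum_def)

lemma hom_eval_mult:
  assumes "exps_le n p" "exps_le n' q"
  shows "hom_eval j (\<lambda>\<alpha>. n \<alpha> + n' \<alpha>) (p * q) v = hom_eval j n p v * hom_eval j n' q v"
  unfolding hom_eval_psum
proof (rule psum_mult)
  fix e e' assume e: "e \<in> Poly_Mapping.keys p" "e' \<in> Poly_Mapping.keys q"
  let ?l = Poly_Mapping.lookup
  have "(\<Prod>\<alpha><j. (v \<alpha> $ 0) ^ ?l (e + e') \<alpha> * (v \<alpha> $ 1) ^ (n \<alpha> + n' \<alpha> - ?l (e + e') \<alpha>)) =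
    (\<Prod>\<alpha><j. ((v \<alpha> $ 0) ^ ?l e \<alpha> * (v \<alpha> $ 1) ^ (n \<alpha> - ?l e \<alpha>)) *
      ((v \<alpha> $ 0) ^ ?l e' \<alpha> * (v \<alpha> $ 1) ^ (n' \<alpha> - ?l e' \<alpha>)))"
  proof (rule prod.cong)
    fix \<alpha>
    have "?l e \<alpha> \<le> n \<alpha>" "?l e' \<alpha> \<le> n' \<alpha>"
      using assms e by (auto simp: exps_le_def)
    then have "n \<alpha> + n' \<alpha> - ?l (e + e') \<alpha> = (n \<alpha> - ?l e \<alpha>) + (n' \<alpha> - ?l e' \<alpha>)"
      by (simp add: lookup_add)
    then show "(v \<alpha> $ 0) ^ ?l (e + e') \<alpha> * (v \<alpha> $ 1) ^ (n \<alpha> + n' \<alpha> - ?l (e + e') \<alpha>) =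
      ((v \<alpha> $ 0) ^ ?l e \<alpha> * (v \<alpha> $ 1) ^ (n \<alpha> - ?l e \<alpha>)) *
      ((v \<alpha> $ 0) ^ ?l e' \<alpha> * (v \<alpha> $ 1) ^ (n' \<alpha> - ?l e' \<alpha>))"
      by (simp only: lookup_add power_add mult_ac)
  qed simp
  then show "?l p e * ?l q e' * (\<Prod>\<alpha><j. (v \<alpha> $ 0) ^ ?l (e + e') \<alpha> *
      (v \<alpha> $ 1) ^ (n \<alpha> + n' \<alpha> - ?l (e + e') \<alpha>)) =
    ?l p e * (\<Prod>\<alpha><j. (v \<alpha> $ 0) ^ ?l e \<alpha> * (v \<alpha> $ 1) ^ (n \<alpha> - ?l e \<alpha>)) *
    (?l q e' * (\<Prod>\<alpha><j. (v \<alpha> $ 0) ^ ?l e' \<alpha> * (v \<alpha> $ 1) ^ (n' \<alpha> - ?l e' \<alpha>)))"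
    by (simp only: prod.distrib mult_ac)
qed (auto simp: distrib_right)

lemma hom_eval_sum: "hom_eval j n (\<Sum>i\<in>I. p i) v = (\<Sum>i\<in>I. hom_eval j n (p i) v)"
  unfolding hom_eval_psum by (rule psum_sum) (auto simp: distrib_right)

lemma hom_eval_single:
  "hom_eval j n (Poly_Mapping.single e r) v =
    r * (\<Prod>\<alpha><j. (v \<alpha> $ 0) ^ Poly_Mapping.lookup e \<alpha> *
      (v \<alpha> $ 1) ^ (n \<alpha> - Poly_Mapping.lookup e \<alpha>))"
  unfolding hom_eval_psum by (rule psum_single) simp

text \<open>Degree bound and evaluated coefficients travel together, since multiplicativity of
  \<open>hom_eval\<close> rests on the bound. \<open>A\<close> is \<open>P\<close> homogenized to
  degree \<open>n\<close> and specialized at \<open>v\<close>.\<close>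

definition homogenizes ::
    "nat \<Rightarrow> (nat \<Rightarrow> complex vec) \<Rightarrow> (nat \<Rightarrow> nat) \<Rightarrow> complex mpolynomial poly \<Rightarrow> complex poly \<Rightarrow> bool"
  where "homogenizes j v n P A \<longleftrightarrow>
    (\<forall>\<kappa>. exps_le n (coeff P \<kappa>) \<and> hom_eval j n (coeff P \<kappa>) v = coeff A \<kappa>)"

lemma homogenizes_mult:
  assumes "homogenizes j v n P A" "homogenizes j v n' Q B"
  shows "homogenizes j v (\<lambda>\<alpha>. n \<alpha> + n' \<alpha>) (P * Q) (A * B)"
  using assms unfolding homogenizes_def coeff_mult
  by (auto simp: hom_eval_sum hom_eval_mult intro!: exps_le_sum exps_le_mult)

lemma homogenizes_1: "homogenizes j v (\<lambda>_. 0) 1 1"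
proof -
  have "hom_eval j (\<lambda>_. 0) 1 v = 1"
    unfolding single_one[symmetric] hom_eval_single by simp
  moreover have "hom_eval j (\<lambda>_. 0) 0 v = 0"
    by (simp add: hom_eval_def)
  ultimately show ?thesis
    by (auto simp: homogenizes_def coeff_1 exps_le_def)
qed

lemma homogenizes_prod:
  assumes "finite I" "\<And>i. i \<in> I \<Longrightarrow> homogenizes j v (n i) (P i) (A i)"
  shows "homogenizes j v (\<lambda>\<alpha>. \<Sum>i\<in>I. n i \<alpha>) (\<Prod>i\<in>I. P i) (\<Prod>i\<in>I. A i)"
  using assms
  by (induction I rule: finite_induct) (auto intro: homogenizes_mult homogenizes_1)

lemma mvar_power: "mvar \<alpha> ^ p = Poly_Mapping.single (Poly_Mapping.single \<alpha> p) (1::'r::comm_ring_1)"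
  by (induction p) (auto simp: mvar_def mult_single single_add[symmetric])

lemma prod_single_factor:
  fixes g :: "nat \<Rightarrow> 'a::comm_monoid_mult"
  assumes "\<alpha> < j" "\<And>\<beta>. \<beta> \<noteq> \<alpha> \<Longrightarrow> g \<beta> = 1"
  shows "(\<Prod>\<beta><j. g \<beta>) = g \<alpha>"
  using assms by (subst prod.remove[of _ \<alpha>]) (auto intro: prod.neutral)

text \<open>The third identity serves the leading coefficient 1 of a factor in \<open>Y\<close>,
  which homogenization turns into a power of the second coordinate.\<close>

lemma hom_eval_power:
  assumes "\<alpha> < j"
  shows "exps_le (\<lambda>\<beta>. if \<beta> = \<alpha> then p else 0) (mconst a * mvar \<alpha> ^ p)"
    and "hom_eval j (\<lambda>\<beta>. if \<beta> = \<alpha> then p else 0) (mconst a * mvar \<alpha> ^ p) v = a * (v \<alpha> $ 0) ^ p"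
    and "hom_eval j (\<lambda>\<beta>. if \<beta> = \<alpha> then p else 0) 1 v = (v \<alpha> $ 1) ^ p"
proof -
  have m: "mconst a * mvar \<alpha> ^ p = Poly_Mapping.single (Poly_Mapping.single \<alpha> p) a"
    by (simp add: mvar_power mconst_def mult_single)
  show "exps_le (\<lambda>\<beta>. if \<beta> = \<alpha> then p else 0) (mconst a * mvar \<alpha> ^ p)"
    by (simp add: m exps_le_def lookup_single when_def)
  show "hom_eval j (\<lambda>\<beta>. if \<beta> = \<alpha> then p else 0) (mconst a * mvar \<alpha> ^ p) v = a * (v \<alpha> $ 0) ^ p"
    unfolding m hom_eval_single
    by (subst prod_single_factor[OF assms]) (auto simp: lookup_single when_def)
  show "hom_eval j (\<lambda>\<beta>. if \<beta> = \<alpha> then p else 0) 1 v = (v \<alpha> $ 1) ^ p"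
    unfolding single_one[symmetric] hom_eval_single
    by (subst prod_single_factor[OF assms]) auto
qed

lemma homogenizes_linear:
  assumes "\<alpha> < j"
  shows "homogenizes j v (\<lambda>\<beta>. if \<beta> = \<alpha> then p else 0)
    ([:0, 1:] + [:mconst a * mvar \<alpha> ^ p:]) [:a * (v \<alpha> $ 0) ^ p, (v \<alpha> $ 1) ^ p:]"
proof -
  have "hom_eval j n 0 v = 0" "exps_le n (0 :: complex mpolynomial)"
    "exps_le n (1 :: complex mpolynomial)" for n
    by (auto simp: hom_eval_def exps_le_def)
  then show ?thesis
    using hom_eval_power[OF assms]
    by (auto simp: homogenizes_def coeff_pCons split: nat.split)
qed

lemma homogenizes_quadratic:
  assumes "\<alpha> < j"
  shows "homogenizes j v (\<lambda>\<beta>. if \<beta> = \<alpha> then p else 0)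
    ([:0, 1:] ^ 2 - [:mconst a * mvar \<alpha> ^ p:]) [:- a * (v \<alpha> $ 0) ^ p, 0, (v \<alpha> $ 1) ^ p:]"
proof -
  have "hom_eval j n 0 v = 0" "exps_le n (0 :: complex mpolynomial)"
    "exps_le n (1 :: complex mpolynomial)" for n
    by (auto simp: hom_eval_def exps_le_def)
  \<comment> \<open>Absorbing the sign into the constant gives the form covered by
    \<open>hom_eval_power\<close>.\<close>
  moreover have "[:0, 1:] ^ 2 - [:mconst a * mvar \<alpha> ^ p:] = [:mconst (- a) * mvar \<alpha> ^ p, 0, 1:]"
    by (simp add: power2_eq_square mconst_def single_uminus)
  ultimately show ?thesis
    using hom_eval_power(1)[OF assms, where a = "- a"] hom_eval_power(2)[OF assms, where a = "- a"]
      hom_eval_power(3)[OF assms]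
    by (auto simp: homogenizes_def coeff_pCons split: nat.split)
qed

section \<open>Polynomial functions\<close>

definition poly_fun :: "(complex \<Rightarrow> complex) \<Rightarrow> bool"
  where "poly_fun f \<longleftrightarrow> (\<exists>p. f = poly p)"

lemma poly_fun_const: "poly_fun (\<lambda>_. c)"
  unfolding poly_fun_def by (rule exI[of _ "[:c:]"]) auto

lemma poly_fun_mult: "poly_fun f \<Longrightarrow> poly_fun g \<Longrightarrow> poly_fun (\<lambda>t. f t * g t)"
  by (auto simp: poly_fun_def simp flip: poly_mult)

lemma poly_fun_power: "poly_fun f \<Longrightarrow> poly_fun (\<lambda>t. f t ^ n)"
  by (induction n) (auto intro: poly_fun_const poly_fun_mult)

lemma poly_fun_add: "poly_fun f \<Longrightarrow> poly_fun g \<Longrightarrow> poly_fun (\<lambda>t. f t + g t)"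
  by (auto simp: poly_fun_def simp flip: poly_add)

lemma poly_fun_sum: "(\<And>i. i \<in> I \<Longrightarrow> poly_fun (f i)) \<Longrightarrow> poly_fun (\<lambda>t. \<Sum>i\<in>I. f i t)"
  by (induction I rule: infinite_finite_induct) (auto intro: poly_fun_const poly_fun_add)

lemma poly_fun_prod: "(\<And>i. i \<in> I \<Longrightarrow> poly_fun (f i)) \<Longrightarrow> poly_fun (\<lambda>t. \<Prod>i\<in>I. f i t)"
  by (induction I rule: infinite_finite_induct) (auto intro: poly_fun_const poly_fun_mult)

text \<open>A polynomial with infinitely many zeros is zero; this carries vanishing from almost all
  points of a curve to every point.\<close>

lemma poly_fun_eq_0:
  assumes "poly_fun f" "finite B" "\<And>t. t \<notin> B \<Longrightarrow> f t = 0"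
  shows "f t = 0"
proof -
  obtain p where p: "f = poly p" using assms(1) by (auto simp: poly_fun_def)
  have "infinite (UNIV - B)"
    using assms(2) by (intro Diff_infinite_finite) (auto simp: infinite_UNIV_char_0)
  moreover have "UNIV - B \<subseteq> {t. poly p t = 0}"
    using assms(3) p by auto
  ultimately have "p = 0"
    using poly_roots_finite finite_subset by blast
  then show ?thesis by (simp add: p)
qed

lemmas poly_fun_intros = poly_fun_sum poly_fun_prod poly_fun_mult poly_fun_power poly_fun_const

section \<open>Trees and weights\<close>

lemma is_treeD:
  assumes "is_tree T"
  shows "finite (nodes T)" "root_node T \<in> nodes T" "edges T \<subseteq> nodes T \<times> nodes T"
    and "x \<in> nodes T \<Longrightarrow> (root_node T, x) \<in> (edges T)\<^sup>*"
    and "x \<in> nodes T \<Longrightarrow> card (children T x) \<le> 2"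
  using assms unfolding is_tree_def by blast+

lemma tree_edge_nodes:
  assumes "is_tree T" "(y, x) \<in> edges T"
  shows "y \<in> nodes T" "x \<in> nodes T" "x \<noteq> root_node T"
  using assms unfolding is_tree_def by blast+

lemma tree_parent_unique:
  assumes "is_tree T" "(y, x) \<in> edges T" "(y', x) \<in> edges T"
  shows "y = y'"
  using assms tree_edge_nodes[OF assms(1,2)] unfolding is_tree_def by blast

lemma tree_parent:
  assumes "is_tree T" "x \<in> nodes T" "x \<noteq> root_node T"
  obtains y where "(y, x) \<in> edges T"
  using assms unfolding is_tree_def by blast

lemma finite_children: "is_tree T \<Longrightarrow> finite (children T x)"
  using is_treeD(1,3) by (fastforce simp: children_def intro: finite_subset[of _ "nodes T"])

text \<open>The parent is unique, so every path that ends in \<open>x\<close> passes through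
  \<open>y\<close> just before.\<close>

lemma root_relpow_Suc_iff:
  assumes "is_tree T" "(y, x) \<in> edges T"
  shows "(root_node T, x) \<in> edges T ^^ Suc n \<longleftrightarrow> (root_node T, y) \<in> edges T ^^ n"
  using assms tree_parent_unique[OF assms(1)] by (auto elim!: relpow_Suc_E)

lemma node_depth_child:
  assumes T: "is_tree T" and xy: "(y, x) \<in> edges T"
  shows "node_depth T x = Suc (node_depth T y)"
proof -
  note x = tree_edge_nodes(2,3)[OF T xy]
  then have "(root_node T, x) \<in> (edges T)\<^sup>*" using is_treeD(4)[OF T] by blast
  then obtain n where "(root_node T, x) \<in> edges T ^^ n" using rtrancl_imp_relpow by blast
  \<comment> \<open>No path of length 0 reaches \<open>x\<close>, so the least length is a successor
    and can be shifted to the parent.\<close>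
  moreover have "(root_node T, x) \<notin> edges T ^^ 0" using x by auto
  ultimately show ?thesis
    unfolding node_depth_def
    by (subst Least_Suc[of "\<lambda>n. (root_node T, x) \<in> edges T ^^ n"])
       (auto simp only: root_relpow_Suc_iff[OF T xy])
qed

lemma node_depth_le: "is_tree T \<Longrightarrow> x \<in> nodes T \<Longrightarrow> node_depth T x \<le> tree_depth T"
  unfolding tree_depth_def by (rule Max_ge) (auto simp: is_treeD(1))

lemma node_depth_less:
  assumes "is_tree T" "(y, x) \<in> edges T"
  shows "node_depth T y < tree_depth T"
  using node_depth_child[OF assms] node_depth_le[OF assms(1) tree_edge_nodes(2)[OF assms]] by simp

lemma node_depth_0:
  assumes "is_tree T" "x \<in> nodes T" "node_depth T x = 0"
  shows "x = root_node T"
proof (rule ccontr)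
  assume "x \<noteq> root_node T"
  then obtain y where "(y, x) \<in> edges T" using assms tree_parent by metis
  then show False using node_depth_child[OF assms(1)] assms(3) by simp
qed

lemma weight_nonzero: "is_weight T w \<Longrightarrow> x \<in> nodes T \<Longrightarrow> w x \<noteq> 0"
  by (auto simp: is_weight_def power_0_left dest!: bspec)

lemma weight_edge:
  assumes "is_weight T w" "(y, x) \<in> edges T"
  shows "w y = (w x)\<^sup>2"
  using assms unfolding is_weight_def by blast

text \<open>Weights separate the nodes of one depth. Squaring shows that the parents have equal
  weights, so they coincide by induction; two different children of one node would have opposite
  nonzero weights.\<close>

lemma weight_inj:
  assumes T: "is_tree T" and w: "is_weight T w"
    and "x \<in> nodes T" "x' \<in> nodes T" "node_depth T x = node_depth T x'" "w x = w x'"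
  shows "x = x'"
  using assms(3-)
proof (induction "node_depth T x" arbitrary: x x')
  case 0
  then show ?case using node_depth_0[OF T] by metis
next
  case (Suc n)
  have "node_depth T (root_node T) = 0"
    unfolding node_depth_def by (rule Least_eq_0) simp
  then have "x \<noteq> root_node T" "x' \<noteq> root_node T" using Suc by auto
  then obtain y y' where y: "(y, x) \<in> edges T" "(y', x') \<in> edges T"
    using tree_parent[OF T] Suc.prems by metis
  have "w y = w y'"
    by (simp only: weight_edge[OF w y(1)] weight_edge[OF w y(2)] Suc.prems(4))
  moreover have "n = node_depth T y" "node_depth T y = node_depth T y'"
    using Suc.hyps(2) Suc.prems y node_depth_child[OF T] by auto
  ultimately have yy: "y = y'"
    using Suc.hyps(1) tree_edge_nodes(1)[OF T] y by metis
  show ?case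
  proof (rule ccontr)
    assume ne: "x \<noteq> x'"
    have ch: "x \<in> children T y" "x' \<in> children T y"
      using y yy by (auto simp: children_def)
    then have "card {x, x'} \<le> card (children T y)"
      using finite_children[OF T] by (intro card_mono) auto
    moreover have "card (children T y) \<le> 2"
      by (rule is_treeD(5)[OF T tree_edge_nodes(1)[OF T y(1)]])
    ultimately have "ramification T y"
      using ne by (simp add: ramification_def)
    then have "w x' = - w x"
      using w ch ne tree_edge_nodes(1)[OF T y(1)] unfolding is_weight_def by blast
    then show False
      using Suc.prems weight_nonzero[OF w, of x] by simp
  qed
qed

text \<open>Every node but the root is a child of exactly one node, so the child counts add up to
  the number of nodes minus one. At each node the child count, plus 2 if it is final or 1 if it has
  a single child, equals 2.\<close>

lemma card_tree_nodes:
  assumes T: "is_tree T"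
  shows "2 * card {u \<in> nodes T. final T u} +
    card {u \<in> nodes T. \<not> final T u \<and> \<not> ramification T u} = card (nodes T) + 1"
proof -
  have fin: "finite (nodes T)" and root: "root_node T \<in> nodes T"
    by (rule is_treeD[OF T])+
  have non_root: "nodes T - {root_node T} = (\<Union>y\<in>nodes T. children T y)"
  proof (intro equalityI subsetI)
    fix x assume "x \<in> nodes T - {root_node T}"
    then obtain y where "(y, x) \<in> edges T" using tree_parent[OF T] by blast
    then show "x \<in> (\<Union>y\<in>nodes T. children T y)"
      using tree_edge_nodes(1)[OF T] by (auto simp: children_def)
  next
    fix x assume "x \<in> (\<Union>y\<in>nodes T. children T y)"
    then obtain y where "(y, x) \<in> edges T" by (auto simp: children_def)
    then show "x \<in> nodes T - {root_node T}"
      using tree_edge_nodes[OF T] by blast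
  qed
  have "children T y \<inter> children T y' = {}" if "y \<noteq> y'" for y y'
    using that tree_parent_unique[OF T] by (auto simp: children_def)
  then have "card (nodes T - {root_node T}) = (\<Sum>y\<in>nodes T. card (children T y))"
    unfolding non_root by (intro card_UN_disjoint ballI impI fin finite_children[OF T])
  then have sum: "(\<Sum>y\<in>nodes T. card (children T y)) + 1 = card (nodes T)"
    using root fin card_Suc_Diff1[of "nodes T" "root_node T"] by simp
  have "card (children T u) + (if final T u then 2 else 0) +
      (if \<not> final T u \<and> \<not> ramification T u then 1 else 0) = 2" if "u \<in> nodes T" for u
  proof -
    have "card (children T u) \<le> 2" by (rule is_treeD(5)[OF T that])
    moreover have "card (children T u) = 0 \<longleftrightarrow> final T u"
      using finite_children[OF T] by (simp add: final_def)
    ultimately show ?thesis by (auto simp: ramification_def)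
  qed
  then have "(\<Sum>u\<in>nodes T. card (children T u) + (if final T u then 2 else 0) +
      (if \<not> final T u \<and> \<not> ramification T u then 1 else 0)) = (\<Sum>u\<in>nodes T. 2)"
    by (intro sum.cong) auto
  moreover have "(\<Sum>u\<in>nodes T. if final T u then 2 else 0) = 2 * card {u \<in> nodes T. final T u}"
    using fin by (simp add: sum.If_cases Int_def)
  moreover have "(\<Sum>u\<in>nodes T. if \<not> final T u \<and> \<not> ramification T u then 1 else 0) =
      card {u \<in> nodes T. \<not> final T u \<and> \<not> ramification T u}"
    using fin by (simp add: sum.If_cases Int_def)
  ultimately show ?thesis
    using sum by (simp add: sum.distrib)
qed

section \<open>Node counts in a forest and its homogenized polynomial\<close>

definition final_nodes :: "nat \<Rightarrow> (nat \<Rightarrow> 'v rooted_tree) \<Rightarrow> (nat \<times> 'v) set"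
  where "final_nodes j T = {(\<alpha>, u)\<in>forest_nodes j T. final (T \<alpha>) u}"

definition unary_nodes :: "nat \<Rightarrow> (nat \<Rightarrow> 'v rooted_tree) \<Rightarrow> (nat \<times> 'v) set"
  where "unary_nodes j T = {(\<alpha>, u)\<in>forest_nodes j T. \<not> final (T \<alpha>) u \<and> \<not> ramification (T \<alpha>) u}"

lemma finite_forest_nodes: "is_forest j T \<Longrightarrow> finite (forest_nodes j T)"
  by (auto simp: is_forest_def forest_nodes_def is_treeD(1))

lemma finite_final_unary:
  assumes "is_forest j T"
  shows "finite (final_nodes j T)" "finite (unary_nodes j T)"
  by (rule finite_subset[OF _ finite_forest_nodes[OF assms]],
      auto simp: final_nodes_def unary_nodes_def)+

text \<open>Each tree contributes a surplus of one. The left side is the degree in \<open>Y\<close>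
  of the forest polynomial, with quadratic factors for final nodes and linear ones for single-child
  nodes.\<close>

lemma card_forest_nodes:
  assumes "is_forest j T"
  shows "2 * card (final_nodes j T) + card (unary_nodes j T) = target_dim j T"
proof -
  have tree: "is_tree (T \<alpha>)" and fin: "finite (nodes (T \<alpha>))" if "\<alpha> < j" for \<alpha>
    using assms that by (auto simp: is_forest_def is_treeD(1))
  have "final_nodes j T = (SIGMA \<alpha>:{..<j}. {u \<in> nodes (T \<alpha>). final (T \<alpha>) u})"
    "unary_nodes j T =
      (SIGMA \<alpha>:{..<j}. {u \<in> nodes (T \<alpha>). \<not> final (T \<alpha>) u \<and> \<not> ramification (T \<alpha>) u})"
    by (auto simp: final_nodes_def unary_nodes_def forest_nodes_def)
  then have "2 * card (final_nodes j T) + card (unary_nodes j T) =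
     (\<Sum>\<alpha><j. 2 * card {u \<in> nodes (T \<alpha>). final (T \<alpha>) u} +
       card {u \<in> nodes (T \<alpha>). \<not> final (T \<alpha>) u \<and> \<not> ramification (T \<alpha>) u})"
    using fin by (simp add: sum.distrib sum_distrib_left)
  also have "\<dots> = (\<Sum>\<alpha><j. card (nodes (T \<alpha>)) + 1)"
    by (intro sum.cong refl card_tree_nodes tree) auto
  also have "\<dots> = card (forest_nodes j T) + j"
    using fin by (simp add: forest_nodes_def sum_Suc)
  finally show ?thesis by (simp add: target_dim_def)
qed

text \<open>The homogenization of \<^const>\<open>frakP\<close>, evaluated at \<open>(c\<^sub>\<alpha>, c'\<^sub>\<alpha>) = (v \<alpha> $ 0, v \<alpha> $ 1)\<close>.\<close>

definition homP ::
    "nat \<Rightarrow> (nat \<Rightarrow> 'v rooted_tree) \<Rightarrow> (nat \<Rightarrow> 'v \<Rightarrow> complex) \<Rightarrow> (nat \<Rightarrow> complex vec) \<Rightarrow> complex poly"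
  where "homP j T w v =
    (\<Prod>(\<alpha>, u)\<in>final_nodes j T.
       let e = 2 ^ (tree_depth (T \<alpha>) - node_depth (T \<alpha>) u)
       in [:- w \<alpha> u * (v \<alpha> $ 0) ^ e, 0, (v \<alpha> $ 1) ^ e:]) *
    (\<Prod>(\<alpha>, u)\<in>unary_nodes j T.
       let e = 2 ^ (tree_depth (T \<alpha>) - node_depth (T \<alpha>) u - 1)
       in [:w \<alpha> (the_elem (children (T \<alpha>) u)) * (v \<alpha> $ 0) ^ e, (v \<alpha> $ 1) ^ e:])"

text \<open>An explicit candidate for \<open>max_deg\<close>, obtained by adding the degrees of the
  individual factors.\<close>

definition exponent_sum :: "nat \<Rightarrow> (nat \<Rightarrow> 'v rooted_tree) \<Rightarrow> nat \<Rightarrow> nat"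
  where "exponent_sum j T \<beta> =
    (\<Sum>(\<alpha>, u)\<in>final_nodes j T.
       if \<beta> = \<alpha> then 2 ^ (tree_depth (T \<alpha>) - node_depth (T \<alpha>) u) else 0) +
    (\<Sum>(\<alpha>, u)\<in>unary_nodes j T.
       if \<beta> = \<alpha> then 2 ^ (tree_depth (T \<alpha>) - node_depth (T \<alpha>) u - 1) else 0)"

lemma homogenizes_frakP:
  assumes "is_forest j T"
  shows "homogenizes j v (exponent_sum j T) (frakP j T w) (homP j T w v)"
  unfolding frakP_def homP_def exponent_sum_def[abs_def] case_prod_unfold Let_def
    final_nodes_def[unfolded case_prod_unfold, symmetric]
    unary_nodes_def[unfolded case_prod_unfold, symmetric]
  by (intro homogenizes_mult homogenizes_prod homogenizes_linear homogenizes_quadratic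
        finite_final_unary assms)
     (auto simp: final_nodes_def unary_nodes_def forest_nodes_def)

lemma degree_prod_le_card:
  assumes "finite I" "\<And>i. i \<in> I \<Longrightarrow> degree (f i) \<le> d"
  shows "degree (\<Prod>i\<in>I. f i) \<le> d * card I"
  using degree_prod_sum_le[OF assms(1), of f] sum_bounded_above[of I "\<lambda>i. degree (f i)" d] assms(2)
  by (simp add: mult.commute o_def)

lemma degree_homP:
  assumes "is_forest j T"
  shows "degree (homP j T w v) \<le> target_dim j T"
  unfolding homP_def card_forest_nodes[OF assms, symmetric]
proof (rule order.trans[OF degree_mult_le add_mono])
  show "degree (\<Prod>(\<alpha>, u)\<in>final_nodes j T.
       let e = 2 ^ (tree_depth (T \<alpha>) - node_depth (T \<alpha>) u)
       in [:- w \<alpha> u * (v \<alpha> $ 0) ^ e, 0, (v \<alpha> $ 1) ^ e:]) \<le> 2 * card (final_nodes j T)"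
    by (rule degree_prod_le_card) (auto simp: finite_final_unary assms Let_def)
  show "degree (\<Prod>(\<alpha>, u)\<in>unary_nodes j T.
       let e = 2 ^ (tree_depth (T \<alpha>) - node_depth (T \<alpha>) u - 1)
       in [:w \<alpha> (the_elem (children (T \<alpha>) u)) * (v \<alpha> $ 0) ^ e, (v \<alpha> $ 1) ^ e:])
     \<le> card (unary_nodes j T)"
    by (rule degree_prod_le_card[where d = 1, unfolded mult_1])
       (auto simp: finite_final_unary assms Let_def)
qed

lemma unary_child:
  assumes T: "is_tree T" and "u \<in> nodes T" "\<not> final T u" "\<not> ramification T u"
  obtains c where "children T u = {c}" "(u, c) \<in> edges T"
proof -
  have "card (children T u) \<le> 2" "card (children T u) \<noteq> 0" "card (children T u) \<noteq> 2"
    using is_treeD(5)[OF T assms(2)] assms(3,4) finite_children[OF T]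
    by (auto simp: final_def ramification_def)
  then have "card (children T u) = 1" by linarith
  then obtain c where "children T u = {c}" by (auto simp: card_1_singleton_iff)
  then show thesis using that by (auto simp: children_def)
qed

lemma ramification_children:
  assumes "ramification T u"
  obtains c c' where "c \<noteq> c'" "children T u = {c, c'}" "(u, c) \<in> edges T" "(u, c') \<in> edges T"
proof -
  obtain c c' where "c \<noteq> c'" "children T u = {c, c'}"
    using assms by (auto simp: ramification_def card_2_iff)
  moreover from this have "(u, c) \<in> edges T" "(u, c') \<in> edges T"
    unfolding children_def by blast+
  ultimately show thesis using that by blast
qed

lemma unary_weight_nonzero:
  assumes "is_forest j T" "is_forest_weight j T w" "(\<alpha>, u) \<in> unary_nodes j T"
  shows "w \<alpha> (the_elem (children (T \<alpha>) u)) \<noteq> 0"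
proof -
  have "is_tree (T \<alpha>)" "is_weight (T \<alpha>) (w \<alpha>)" "u \<in> nodes (T \<alpha>)"
    "\<not> final (T \<alpha>) u" "\<not> ramification (T \<alpha>) u"
    using assms by (auto simp: is_forest_def is_forest_weight_def unary_nodes_def forest_nodes_def)
  then show ?thesis
    by (metis unary_child the_elem_eq weight_nonzero tree_edge_nodes(2))
qed

lemma final_weight_nonzero:
  assumes "is_forest_weight j T w" "(\<alpha>, u) \<in> final_nodes j T"
  shows "w \<alpha> u \<noteq> 0"
  using assms weight_nonzero[of "T \<alpha>" "w \<alpha>" u]
  by (auto simp: is_forest_weight_def final_nodes_def forest_nodes_def)

text \<open>Weights are nonzero and so is one coordinate of each pair, hence every factor has a
  nonzero coefficient.\<close>

lemma homP_nonzero: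
  assumes "is_forest j T" "is_forest_weight j T w"
    and "\<And>\<alpha>. \<alpha> < j \<Longrightarrow> v \<alpha> $ 0 \<noteq> 0 \<or> v \<alpha> $ 1 \<noteq> 0"
  shows "homP j T w v \<noteq> 0"
proof -
  have "\<alpha> < j" if "(\<alpha>, u) \<in> final_nodes j T \<union> unary_nodes j T" for \<alpha> u
    using that by (auto simp: final_nodes_def unary_nodes_def forest_nodes_def)
  then show ?thesis
    using assms finite_final_unary[OF assms(1)]
      unary_weight_nonzero[OF assms(1,2)] final_weight_nonzero[OF assms(2)]
    by (fastforce simp: homP_def Let_def)
qed

text \<open>The factors bound the degree from above. The bound is attained: at the point with all
  pairs equal to \<open>(1, 0)\<close> the constant coefficient is up to sign a product of weights,
  while monomials of smaller degree in the chosen variable vanish there.\<close>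

lemma max_deg_eq:
  assumes F: "is_forest j T" and w: "is_forest_weight j T w" and \<alpha>: "\<alpha> < j"
  shows "max_deg j T w \<alpha> = exponent_sum j T \<alpha>"
proof -
  let ?E = "(\<Union>\<kappa>\<in>{0..target_dim j T}. Poly_Mapping.keys (lam j T w \<kappa>))"
  note hom = homogenizes_frakP[OF F, of _ w]
  \<comment> \<open>The exponent bounds do not involve the evaluation point, so an arbitrary one
    serves.\<close>
  have le: "Poly_Mapping.lookup e \<alpha> \<le> exponent_sum j T \<alpha>" if "e \<in> ?E" for e
    using that hom[of undefined] by (auto simp: homogenizes_def lam_def exps_le_def)
  have "\<exists>e\<in>Poly_Mapping.keys (lam j T w 0). Poly_Mapping.lookup e \<alpha> \<ge> exponent_sum j T \<alpha>"
  proof (rule ccontr)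
    assume "\<not> ?thesis"
    then have less: "Poly_Mapping.lookup e \<alpha> < exponent_sum j T \<alpha>"
      if "e \<in> Poly_Mapping.keys (lam j T w 0)" for e
      using that by auto
    define v :: "nat \<Rightarrow> complex vec" where "v = (\<lambda>_. vec 2 (\<lambda>i. if i = 0 then 1 else 0))"
    have "hom_eval j (exponent_sum j T) (lam j T w 0) v = 0"
      unfolding hom_eval_def using less \<alpha>
      by (intro sum.neutral ballI) (auto simp: v_def intro!: prod_zero bexI[of _ \<alpha>])
    moreover have "hom_eval j (exponent_sum j T) (lam j T w 0) v = coeff (homP j T w v) 0"
      using hom by (simp add: homogenizes_def lam_def)
    moreover have "coeff (homP j T w v) 0 \<noteq> 0"
      using finite_final_unary[OF F] unary_weight_nonzero[OF F w] final_weight_nonzero[OF w]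
      by (auto simp: homP_def Let_def poly_prod v_def simp flip: poly_0_coeff_0)
    ultimately show False by simp
  qed
  then obtain e where e: "e \<in> Poly_Mapping.keys (lam j T w 0)"
    "exponent_sum j T \<alpha> \<le> Poly_Mapping.lookup e \<alpha>" by blast
  then have eE: "e \<in> ?E" by auto
  show ?thesis
    unfolding max_deg_def
  proof (rule Max_eqI)
    show "exponent_sum j T \<alpha> \<in> (\<lambda>e. Poly_Mapping.lookup e \<alpha>) ` ?E"
      by (rule image_eqI[OF _ eE]) (rule antisym[OF e(2) le[OF eE]])
  qed (use le in auto)
qed

lemma hom_eval_cong:
  assumes "\<And>\<alpha>. \<alpha> < j \<Longrightarrow> n \<alpha> = n' \<alpha>"
  shows "hom_eval j n p v = hom_eval j n' p v"
  using assms by (simp add: hom_eval_def)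

lemma hom_eval_lam:
  assumes "is_forest j T" "is_forest_weight j T w"
  shows "hom_eval j (max_deg j T w) (lam j T w \<kappa>) v = coeff (homP j T w v) \<kappa>"
  using homogenizes_frakP[OF assms(1), of v w]
  by (simp add: hom_eval_cong[OF max_deg_eq[OF assms]] homogenizes_def lam_def)

section \<open>Node values and generic points\<close>

definition node_value ::
    "(nat \<Rightarrow> 'v rooted_tree) \<Rightarrow> (nat \<Rightarrow> 'v \<Rightarrow> complex) \<Rightarrow> (nat \<Rightarrow> complex) \<Rightarrow> nat \<times> 'v \<Rightarrow> complex"
  where "node_value T w c = (\<lambda>(\<alpha>, u). w \<alpha> u * c \<alpha> ^ (2 ^ (tree_depth (T \<alpha>) - node_depth (T \<alpha>) u)))"

lemma node_value_child:
  assumes "is_tree (T \<alpha>)" "is_weight (T \<alpha>) (w \<alpha>)" "(u, x) \<in> edges (T \<alpha>)"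
  shows "node_value T w c (\<alpha>, u) = (node_value T w c (\<alpha>, x))\<^sup>2"
proof -
  have "tree_depth (T \<alpha>) - node_depth (T \<alpha>) u = Suc (tree_depth (T \<alpha>) - node_depth (T \<alpha>) x)"
    using node_depth_child[OF assms(1,3)] node_depth_less[OF assms(1,3)] by simp
  then show ?thesis
    by (simp add: node_value_def weight_edge[OF assms(2,3)] power_mult_distrib power_mult[symmetric] mult.commute)
qed

text \<open>After clearing denominators, the factor of a final node vanishes at both square roots of
  its value.\<close>

lemma poly_homP_final:
  assumes F: "is_forest j T" and u: "(\<alpha>, u) \<in> final_nodes j T" and "v \<alpha> $ 1 \<noteq> 0"
    and x: "x\<^sup>2 = node_value T w (\<lambda>\<alpha>. v \<alpha> $ 0 / v \<alpha> $ 1) (\<alpha>, u)"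
  shows "poly (homP j T w v) x = 0"
proof -
  define e :: nat where "e = 2 ^ (tree_depth (T \<alpha>) - node_depth (T \<alpha>) u)"
  have "(v \<alpha> $ 1) ^ e * x\<^sup>2 = w \<alpha> u * (v \<alpha> $ 0) ^ e"
    unfolding x node_value_def using assms(3) by (simp add: e_def[symmetric] power_divide)
  then have "poly [:- w \<alpha> u * (v \<alpha> $ 0) ^ e, 0, (v \<alpha> $ 1) ^ e:] x = 0"
    by (simp add: power2_eq_square algebra_simps)
  then show ?thesis
    unfolding homP_def poly_mult poly_prod Let_def mult_eq_0_iff e_def
    by (intro disjI1 prod_zero finite_final_unary[OF F] bexI[OF _ u]) simp
qed

text \<open>The factor of a single-child node removes the square root opposite to the value of the
  child. The child lies one level deeper, whence the exponent lowered by one.\<close>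

lemma poly_homP_unary:
  assumes F: "is_forest j T" and u: "(\<alpha>, u) \<in> unary_nodes j T" and "v \<alpha> $ 1 \<noteq> 0"
    and x: "(u, x) \<in> edges (T \<alpha>)" "children (T \<alpha>) u = {x}"
  shows "poly (homP j T w v) (- node_value T w (\<lambda>\<alpha>. v \<alpha> $ 0 / v \<alpha> $ 1) (\<alpha>, x)) = 0"
proof -
  have T: "is_tree (T \<alpha>)"
    using F u by (auto simp: is_forest_def unary_nodes_def forest_nodes_def)
  define e :: nat where "e = 2 ^ (tree_depth (T \<alpha>) - node_depth (T \<alpha>) u - 1)"
  have "(v \<alpha> $ 1) ^ e * node_value T w (\<lambda>\<alpha>. v \<alpha> $ 0 / v \<alpha> $ 1) (\<alpha>, x) = w \<alpha> x * (v \<alpha> $ 0) ^ e"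
    unfolding node_value_def using assms(3) by (simp add: e_def node_depth_child[OF T x(1)] power_divide)
  then have "poly [:w \<alpha> (the_elem (children (T \<alpha>) u)) * (v \<alpha> $ 0) ^ e, (v \<alpha> $ 1) ^ e:]
      (- node_value T w (\<lambda>\<alpha>. v \<alpha> $ 0 / v \<alpha> $ 1) (\<alpha>, x)) = 0"
    by (simp add: x(2) mult.commute)
  then show ?thesis
    unfolding homP_def poly_mult poly_prod Let_def mult_eq_0_iff e_def
    by (intro disjI2 prod_zero finite_final_unary[OF F] bexI[OF _ u]) simp
qed

text \<open>At a final node both square roots are zeros of the polynomial; with a single child one
  is a zero and the other is the value of the child; at a ramification node opposite weights make
  the two children supply both.\<close>

lemma forest_node_square_root:
  assumes F: "is_forest j T" and w: "is_forest_weight j T w" and v: "\<And>\<alpha>. \<alpha> < j \<Longrightarrow> v \<alpha> $ 1 \<noteq> 0"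
    and u: "(\<alpha>, u) \<in> forest_nodes j T"
  defines "\<zeta> \<equiv> node_value T w (\<lambda>\<alpha>. v \<alpha> $ 0 / v \<alpha> $ 1)"
  shows "\<exists>y. y\<^sup>2 = \<zeta> (\<alpha>, u) \<and> (\<forall>x\<in>{y, - y}. poly (homP j T w v) x = 0 \<or>
    (\<exists>c. (u, c) \<in> edges (T \<alpha>) \<and> \<zeta> (\<alpha>, c) = x))"
proof -
  have \<alpha>: "\<alpha> < j" "u \<in> nodes (T \<alpha>)" and T: "is_tree (T \<alpha>)" and wT: "is_weight (T \<alpha>) (w \<alpha>)"
    using F w u by (auto simp: is_forest_def is_forest_weight_def forest_nodes_def)
  note child = node_value_child[where T = T and \<alpha> = \<alpha> and w = w and c = "\<lambda>\<alpha>. v \<alpha> $ 0 / v \<alpha> $ 1",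
      OF T wT, folded \<zeta>_def]
  consider "final (T \<alpha>) u" | "\<not> final (T \<alpha>) u" "\<not> ramification (T \<alpha>) u" | "ramification (T \<alpha>) u"
    by blast
  then show ?thesis
  proof cases
    case 1
    then have uF: "(\<alpha>, u) \<in> final_nodes j T" using u by (simp add: final_nodes_def)
    have "poly (homP j T w v) x = 0" if "x\<^sup>2 = \<zeta> (\<alpha>, u)" for x
      using poly_homP_final[where v = v, OF F uF v[OF \<alpha>(1)]] that by (simp add: \<zeta>_def)
    then show ?thesis
      by (intro exI[of _ "csqrt (\<zeta> (\<alpha>, u))"]) auto
  next
    case 2
    then obtain c where c: "children (T \<alpha>) u = {c}" "(u, c) \<in> edges (T \<alpha>)"
      using unary_child[OF T \<alpha>(2)] by blast
    have "(\<alpha>, u) \<in> unary_nodes j T" using u 2 by (simp add: unary_nodes_def)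
    then have "poly (homP j T w v) (- \<zeta> (\<alpha>, c)) = 0"
      unfolding \<zeta>_def using poly_homP_unary[where v = v, OF F _ v[OF \<alpha>(1)] c(2,1)] by blast
    then show ?thesis
      using child[OF c(2)] c(2) by (intro exI[of _ "\<zeta> (\<alpha>, c)"]) auto
  next
    case 3
    then obtain c c' where c: "c \<noteq> c'" "children (T \<alpha>) u = {c, c'}"
        "(u, c) \<in> edges (T \<alpha>)" "(u, c') \<in> edges (T \<alpha>)"
      using ramification_children by metis
    then have "w \<alpha> c' = - w \<alpha> c"
      using wT 3 \<alpha>(2) unfolding is_weight_def by blast
    then have "\<zeta> (\<alpha>, c') = - \<zeta> (\<alpha>, c)"
      using c by (simp add: \<zeta>_def node_value_def node_depth_child[OF T])
    then show ?thesis
      using child[OF c(3)] c(3,4) by (intro exI[of _ "\<zeta> (\<alpha>, c)"]) auto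
  qed
qed

text \<open>With distinct nonzero node values, listing children before parents gives the triangular
  form. The factor \<open>s\<close> covers every representative of a projective point.\<close>

lemma homP_vanish_generic:
  assumes j: "j \<ge> 1" and F: "is_forest j T" and w: "is_forest_weight j T w"
    and v0: "\<And>\<alpha>. \<alpha> < j \<Longrightarrow> v \<alpha> $ 0 \<noteq> 0" and v1: "\<And>\<alpha>. \<alpha> < j \<Longrightarrow> v \<alpha> $ 1 \<noteq> 0"
    and inj: "inj_on (node_value T w (\<lambda>\<alpha>. v \<alpha> $ 0 / v \<alpha> $ 1)) (forest_nodes j T)"
    and \<iota>: "\<iota> < card (forest_nodes j T)"
  shows "eval_int (Dpoly (target_dim j T) \<iota>) (\<lambda>\<kappa>. s * coeff (homP j T w v) \<kappa>) = 0"
proof -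
  let ?N = "forest_nodes j T"
  let ?\<zeta> = "node_value T w (\<lambda>\<alpha>. v \<alpha> $ 0 / v \<alpha> $ 1)"
  let ?h = "\<lambda>(\<alpha>, u). tree_depth (T \<alpha>) - node_depth (T \<alpha>) u"
  obtain L0 where L0: "set L0 = ?N" "distinct L0"
    using finite_distinct_list[OF finite_forest_nodes[OF F]] by blast
  \<comment> \<open>The key decreases from a node to its child, so children come first in the
    list.\<close>
  define L where "L = sort_key ?h L0"
  have L: "set L = ?N" "distinct L" "sorted (map ?h L)"
    using L0 by (auto simp: L_def)
  then have len: "length L = card ?N" by (metis distinct_card)
  have nth: "L ! k \<in> ?N" if "k < length L" for k
    using L(1) that nth_mem by blast
  \<comment> \<open>Scaling keeps all zeros of \<open>homP\<close> and does not raise its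
    degree.\<close>
  define P where "P = smult s (homP j T w v)"
  have "coeff (det (map_mat (\<lambda>p. [:p:]) (frakM (target_dim j T) (coeff P)) -
      [:0, 1:] \<cdot>\<^sub>m 1\<^sub>m (target_dim j T - 1))) \<iota> = 0"
  proof (rule coeff_det_frakM_zero[where z = "\<lambda>k. ?\<zeta> (L ! k)" and k = "length L"])
    show "degree P \<le> target_dim j T"
      unfolding P_def using degree_homP[OF F] by (metis degree_smult_le order.trans)
    show "length L \<le> target_dim j T - 1"
      using j by (simp add: len target_dim_def)
    show "inj_on (\<lambda>k. ?\<zeta> (L ! k)) {..<length L}"
    proof (rule inj_onI)
      fix k l assume kl: "k \<in> {..<length L}" "l \<in> {..<length L}" "?\<zeta> (L ! k) = ?\<zeta> (L ! l)"
      then have "L ! k = L ! l" using inj_onD[OF inj] nth by simp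
      then show "k = l" using kl L(2) by (simp add: nth_eq_iff_index_eq)
    qed
    show "?\<zeta> (L ! k) \<noteq> 0" if "k < length L" for k
    proof -
      obtain \<alpha> u where k: "L ! k = (\<alpha>, u)" by fastforce
      then have \<alpha>: "\<alpha> < j" "u \<in> nodes (T \<alpha>)"
        using nth[OF that] by (simp_all add: forest_nodes_def)
      then have "w \<alpha> u \<noteq> 0"
        using w weight_nonzero[of "T \<alpha>" "w \<alpha>" u] by (simp add: is_forest_weight_def)
      then show ?thesis
        unfolding k node_value_def using v0[OF \<alpha>(1)] v1[OF \<alpha>(1)] by simp
    qed
    show "\<iota> < length L" using \<iota> len by simp
  next
    fix k assume k: "k < length L"
    obtain \<alpha> u where ku: "L ! k = (\<alpha>, u)" by fastforce
    have u: "(\<alpha>, u) \<in> ?N" using nth[OF k] ku by simp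
    then have T: "is_tree (T \<alpha>)" and "\<alpha> < j"
      using F by (auto simp: is_forest_def forest_nodes_def)
    have earlier: "\<exists>l<k. L ! l = (\<alpha>, c)" if c: "(u, c) \<in> edges (T \<alpha>)" for c
    proof -
      have "(\<alpha>, c) \<in> set L"
        using tree_edge_nodes(2)[OF T c] \<open>\<alpha> < j\<close> L(1) by (simp add: forest_nodes_def)
      then obtain l where l: "l < length L" "L ! l = (\<alpha>, c)" by (metis in_set_conv_nth)
      have "?h (\<alpha>, c) < ?h (\<alpha>, u)"
        using node_depth_child[OF T c] node_depth_less[OF T c] by simp
      then have "l < k"
        using sorted_nth_mono[OF L(3), of k l] l ku by (fastforce simp: not_le[symmetric])
      then show ?thesis using l by blast
    qed
    obtain y where "y\<^sup>2 = ?\<zeta> (\<alpha>, u)" "\<forall>x\<in>{y, - y}. poly (homP j T w v) x = 0 \<or>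
        (\<exists>c. (u, c) \<in> edges (T \<alpha>) \<and> ?\<zeta> (\<alpha>, c) = x)"
      using forest_node_square_root[where v = v, OF F w v1 u] by blast
    then show "\<exists>y. y\<^sup>2 = ?\<zeta> (L ! k) \<and>
        (\<forall>x\<in>{y, - y}. poly P x = 0 \<or> (\<exists>l<k. ?\<zeta> (L ! l) = x))"
      unfolding ku P_def poly_smult mult_eq_0_iff by (metis earlier)
  qed
  then show ?thesis
    by (simp add: eval_int_Dpoly P_def coeff_smult[abs_def])
qed

section \<open>Generic points on polynomial curves\<close>

lemma odd_times_power_of_two_eq:
  fixes \<alpha> \<beta> :: nat
  assumes "(2 * \<alpha> + 1) * 2 ^ a = (2 * \<beta> + 1) * 2 ^ b"
  shows "\<alpha> = \<beta>" "a = b"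
proof -
  have "\<alpha> = \<beta> \<and> a = b"
    using assms
  proof (induction a arbitrary: b)
    case 0
    then have "odd ((2 * \<beta> + 1) * 2 ^ b)" by (metis mult_1_right odd_two_times_div_two_succ power_0 even_plus_one_iff dvd_triv_left)
    then have "b = 0" by (cases b) auto
    then show ?case using 0 by simp
  next
    case (Suc a)
    then have "even ((2 * \<beta> + 1) * 2 ^ b)" by (metis dvd_triv_right dvd_mult dvd_triv_left power_Suc)
    then obtain b' where "b = Suc b'" by (cases b) auto
    then have "2 * ((2 * \<alpha> + 1) * 2 ^ a) = 2 * ((2 * \<beta> + 1) * 2 ^ b')"
      using Suc.prems by (simp only: power_Suc mult.left_commute)
    then have "(2 * \<alpha> + 1) * 2 ^ a = (2 * \<beta> + 1) * 2 ^ b'" by linarith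
    then show ?case using Suc.IH \<open>b = Suc b'\<close> by simp
  qed
  then show "\<alpha> = \<beta>" "a = b" by auto
qed

text \<open>
  Through every point there is a polynomial curve along which \<open>c\<^sub>\<alpha>/c'\<^sub>\<alpha>\<close> grows like
  \<open>t ^ (2 \<alpha> + 1)\<close>; as the numbers \<open>(2 \<alpha> + 1) 2 ^ a\<close> are pairwise different, the node values are
  distinct for almost all \<open>t\<close>.
\<close>

definition curve :: "(nat \<Rightarrow> complex vec) \<Rightarrow> complex \<Rightarrow> nat \<Rightarrow> complex vec"
  where "curve v t \<alpha> = vec 2 (\<lambda>i. if i = 0 then v \<alpha> $ 0 + t ^ (2 * \<alpha> + 2) else v \<alpha> $ 1 + t)"

text \<open>If two node values agreed identically along the curve, comparing degrees in
  \<open>t\<close> would give the same tree and depth, then the same weight, and by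
  \<open>weight_inj\<close> the same node. So the exceptional parameters are zeros of finitely many
  nonzero polynomials.\<close>

lemma finite_non_generic:
  assumes F: "is_forest j T" and w: "is_forest_weight j T w"
  obtains B where "finite B"
    "\<And>t \<alpha>. t \<notin> B \<Longrightarrow> \<alpha> < j \<Longrightarrow> curve v t \<alpha> $ 0 \<noteq> 0 \<and> curve v t \<alpha> $ 1 \<noteq> 0"
    "\<And>t. t \<notin> B \<Longrightarrow>
      inj_on (node_value T w (\<lambda>\<alpha>. curve v t \<alpha> $ 0 / curve v t \<alpha> $ 1)) (forest_nodes j T)"
proof -
  let ?N = "forest_nodes j T"
  define X where "X = (\<lambda>\<alpha>. [:v \<alpha> $ 0:] + monom 1 (2 * \<alpha> + 2))"
  define Y where "Y = (\<lambda>\<alpha>. [:v \<alpha> $ 1, 1:])"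
  define e :: "nat \<times> 'a \<Rightarrow> nat" where "e = (\<lambda>(\<alpha>, u). 2 ^ (tree_depth (T \<alpha>) - node_depth (T \<alpha>) u))"
  \<comment> \<open>The difference of two node values after clearing denominators.\<close>
  define R where "R = (\<lambda>(a, b).
    smult (w (fst a) (snd a)) (X (fst a) ^ e a * Y (fst b) ^ e b) -
    smult (w (fst b) (snd b)) (X (fst b) ^ e b * Y (fst a) ^ e a))"
  have c: "curve v t \<alpha> $ 0 = poly (X \<alpha>) t" "curve v t \<alpha> $ 1 = poly (Y \<alpha>) t" for t \<alpha>
    by (simp_all add: curve_def X_def Y_def poly_monom)
  have degX: "degree (X \<alpha>) = 2 * \<alpha> + 2" for \<alpha>
    unfolding X_def by (subst degree_add_eq_right) (auto simp: degree_monom_eq)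
  have degY: "degree (Y \<alpha>) = 1" for \<alpha> by (simp add: Y_def)
  have XY: "X \<alpha> \<noteq> 0" "Y \<alpha> \<noteq> 0" for \<alpha> using degX[of \<alpha>] degY[of \<alpha>] by auto
  have R: "R (a, b) \<noteq> 0" if ab: "a \<in> ?N" "b \<in> ?N" "a \<noteq> b" for a b
  proof
    assume R0: "R (a, b) = 0"
    obtain \<alpha> u \<beta> u' where a: "a = (\<alpha>, u)" and b: "b = (\<beta>, u')" by fastforce
    have \<alpha>: "\<alpha> < j" "u \<in> nodes (T \<alpha>)" "\<beta> < j" "u' \<in> nodes (T \<beta>)"
      using ab a b by (auto simp: forest_nodes_def)
    then have T: "is_tree (T \<alpha>)" "is_tree (T \<beta>)" and wT: "is_weight (T \<alpha>) (w \<alpha>)" "is_weight (T \<beta>) (w \<beta>)"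
      using F w by (auto simp: is_forest_def is_forest_weight_def)
    have w0: "w \<alpha> u \<noteq> 0" "w \<beta> u' \<noteq> 0"
      using weight_nonzero[OF wT(1) \<alpha>(2)] weight_nonzero[OF wT(2) \<alpha>(4)] .
    have eq: "smult (w \<alpha> u) (X \<alpha> ^ e a * Y \<beta> ^ e b) = smult (w \<beta> u') (X \<beta> ^ e b * Y \<alpha> ^ e a)"
      using R0 by (simp add: R_def a b)
    then have "degree (smult (w \<alpha> u) (X \<alpha> ^ e a * Y \<beta> ^ e b)) =
        degree (smult (w \<beta> u') (X \<beta> ^ e b * Y \<alpha> ^ e a))" by simp
    then have "(2 * \<alpha> + 2) * e a + e b = (2 * \<beta> + 2) * e b + e a"
      using w0 XY by (simp add: degree_mult_eq degree_power_eq degX degY mult.commute)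
    \<comment> \<open>The denominators have degree 1 in \<open>t\<close>; cancelling their
      contribution leaves odd multiples of powers of two.\<close>
    then have "(2 * \<alpha> + 1) * e a = (2 * \<beta> + 1) * e b" by simp
    then have "(2 * \<alpha> + 1) * 2 ^ (tree_depth (T \<alpha>) - node_depth (T \<alpha>) u) =
        (2 * \<beta> + 1) * 2 ^ (tree_depth (T \<beta>) - node_depth (T \<beta>) u')"
      by (simp only: e_def a b prod.case)
    note odd_times_power_of_two_eq[OF this]
    then have "\<alpha> = \<beta>"
      and d: "tree_depth (T \<alpha>) - node_depth (T \<alpha>) u = tree_depth (T \<beta>) - node_depth (T \<beta>) u'" .
    have "node_depth (T \<alpha>) u = node_depth (T \<alpha>) u'"
      using d node_depth_le[OF T(1), of u] node_depth_le[OF T(1), of u'] \<alpha> \<open>\<alpha> = \<beta>\<close> by simp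
    moreover have "e a = e b" using d \<open>\<alpha> = \<beta>\<close> by (simp add: e_def a b)
    \<comment> \<open>Tree and exponent agree, so both sides are multiples of one nonzero polynomial
      and only the weights can differ.\<close>
    then have "smult (w \<alpha> u - w \<alpha> u') (X \<alpha> ^ e a * Y \<alpha> ^ e a) = 0"
      using eq \<open>\<alpha> = \<beta>\<close> by (simp add: smult_diff_left)
    then have "w \<alpha> u = w \<alpha> u'" using XY by simp
    ultimately have "u = u'"
      using weight_inj[OF T(1) wT(1)] \<alpha> \<open>\<alpha> = \<beta>\<close> by simp
    then show False using ab a b \<open>\<alpha> = \<beta>\<close> by simp
  qed
  define B where "B = (\<Union>\<alpha><j. {t. poly (X \<alpha>) t = 0} \<union> {t. poly (Y \<alpha>) t = 0}) \<union>
    (\<Union>p\<in>{p \<in> ?N \<times> ?N. fst p \<noteq> snd p}. {t. poly (R p) t = 0})"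
  show thesis
  proof (rule that)
    show "finite B"
      unfolding B_def using XY R finite_forest_nodes[OF F]
      by (intro finite_UnI finite_UN_I) (auto intro!: poly_roots_finite)
    show nz: "curve v t \<alpha> $ 0 \<noteq> 0 \<and> curve v t \<alpha> $ 1 \<noteq> 0" if "t \<notin> B" "\<alpha> < j" for t \<alpha>
      using that unfolding B_def c by auto
    fix t assume t: "t \<notin> B"
    show "inj_on (node_value T w (\<lambda>\<alpha>. curve v t \<alpha> $ 0 / curve v t \<alpha> $ 1)) ?N"
    proof (rule inj_onI, rule ccontr)
      fix a b assume ab: "a \<in> ?N" "b \<in> ?N" "a \<noteq> b"
        and eq: "node_value T w (\<lambda>\<alpha>. curve v t \<alpha> $ 0 / curve v t \<alpha> $ 1) a =
          node_value T w (\<lambda>\<alpha>. curve v t \<alpha> $ 0 / curve v t \<alpha> $ 1) b"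
      have "poly (Y (fst a)) t \<noteq> 0" "poly (Y (fst b)) t \<noteq> 0"
        using nz[OF t] ab unfolding c by (auto simp: forest_nodes_def)
      then have "poly (R (a, b)) t = 0"
        using eq unfolding R_def node_value_def e_def c
        by (simp add: case_prod_unfold power_divide field_simps)
      then have "t \<in> B"
        unfolding B_def using ab by (intro UnI2 UN_I[of "(a, b)"]) simp_all
      then show False using t by simp
    qed
  qed
qed

text \<open>The value along the curve is a polynomial in \<open>t\<close> that vanishes at all
  generic parameters, hence also at \<open>t = 0\<close>, the given point.\<close>

lemma eval_Dpoly_homP:
  assumes j: "j \<ge> 1" and F: "is_forest j T" and w: "is_forest_weight j T w"
    and \<iota>: "\<iota> < card (forest_nodes j T)"
  shows "eval_int (Dpoly (target_dim j T) \<iota>) (\<lambda>\<kappa>. s * coeff (homP j T w v) \<kappa>) = 0"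
proof -
  \<comment> \<open>Written with \<open>hom_eval\<close>, the function is a finite expression in the
    coordinates of the curve and so visibly polynomial in \<open>t\<close>.\<close>
  define g where "g = (\<lambda>t. eval_int (Dpoly (target_dim j T) \<iota>)
    (\<lambda>\<kappa>. s * hom_eval j (max_deg j T w) (lam j T w \<kappa>) (curve v t)))"
  obtain B where B: "finite B"
    "\<And>t \<alpha>. t \<notin> B \<Longrightarrow> \<alpha> < j \<Longrightarrow> curve v t \<alpha> $ 0 \<noteq> 0 \<and> curve v t \<alpha> $ 1 \<noteq> 0"
    "\<And>t. t \<notin> B \<Longrightarrow>
      inj_on (node_value T w (\<lambda>\<alpha>. curve v t \<alpha> $ 0 / curve v t \<alpha> $ 1)) (forest_nodes j T)"
    using finite_non_generic[OF F w, of v] by blast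
  have "poly_fun (\<lambda>t. curve v t \<alpha> $ 0)" "poly_fun (\<lambda>t. curve v t \<alpha> $ 1)" for \<alpha>
    unfolding poly_fun_def
    by (rule exI[of _ "[:v \<alpha> $ 0:] + monom 1 (2 * \<alpha> + 2)"], simp add: curve_def poly_monom fun_eq_iff)
       (rule exI[of _ "[:v \<alpha> $ 1, 1:]"], simp add: curve_def fun_eq_iff)
  then have "poly_fun g"
    unfolding g_def eval_int_def hom_eval_def by (intro poly_fun_intros)
  then have "g 0 = 0"
  proof (rule poly_fun_eq_0[OF _ B(1)])
    show "g t = 0" if "t \<notin> B" for t
      unfolding g_def hom_eval_lam[OF F w]
      using B that by (intro homP_vanish_generic j F w \<iota>) auto
  qed
  \<comment> \<open>The powers of \<open>t\<close> in the curve have positive exponents, and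
    \<open>hom_eval\<close> reads only the entries 0 and 1.\<close>
  moreover have "hom_eval j n p (curve v 0) = hom_eval j n p v" for n p
    by (simp add: hom_eval_def curve_def)
  ultimately show ?thesis
    unfolding g_def by (simp add: hom_eval_lam[OF F w])
qed

section \<open>The map on projective lines\<close>

text \<open>Each factor is homogeneous in the coordinate pair of its tree, so rescaling the pairs
  pulls out one common scalar.\<close>

lemma homP_scale:
  assumes v': "\<And>\<alpha>. \<alpha> < j \<Longrightarrow> v' \<alpha> $ 0 = d \<alpha> * v \<alpha> $ 0 \<and> v' \<alpha> $ 1 = d \<alpha> * v \<alpha> $ 1"
    and d: "\<And>\<alpha>. \<alpha> < j \<Longrightarrow> d \<alpha> \<noteq> 0" and F: "is_forest j T"
  obtains c where "c \<noteq> 0" "homP j T w v' = smult c (homP j T w v)"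
proof -
  let ?e = "\<lambda>p. tree_depth (T (fst p)) - node_depth (T (fst p)) (snd p)"
  define a where "a = (\<Prod>p\<in>final_nodes j T. d (fst p) ^ 2 ^ ?e p)"
  define b where "b = (\<Prod>p\<in>unary_nodes j T. d (fst p) ^ 2 ^ (?e p - 1))"
  have j: "fst p < j" if "p \<in> final_nodes j T \<or> p \<in> unary_nodes j T" for p
    using that by (auto simp: final_nodes_def unary_nodes_def forest_nodes_def)
  have "a * b \<noteq> 0"
    unfolding a_def b_def using finite_final_unary[OF F] d[OF j] by simp
  moreover have "homP j T w v' = smult (a * b) (homP j T w v)"
  proof -
    have "homP j T w v' =
      (\<Prod>p\<in>final_nodes j T. smult (d (fst p) ^ 2 ^ ?e p)
        [:- w (fst p) (snd p) * (v (fst p) $ 0) ^ 2 ^ ?e p, 0, (v (fst p) $ 1) ^ 2 ^ ?e p:]) *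
      (\<Prod>p\<in>unary_nodes j T. smult (d (fst p) ^ 2 ^ (?e p - 1))
        [:w (fst p) (the_elem (children (T (fst p)) (snd p))) * (v (fst p) $ 0) ^ 2 ^ (?e p - 1),
          (v (fst p) $ 1) ^ 2 ^ (?e p - 1):])"
      unfolding homP_def Let_def case_prod_unfold
      by (intro arg_cong2[where f = "(*)"] prod.cong refl)
         (simp_all add: v'[OF j] power_mult_distrib mult_ac del: One_nat_def)
    then show ?thesis
      unfolding homP_def Let_def case_prod_unfold prod_smult a_def b_def
      by (simp only: mult_smult_left mult_smult_right smult_smult mult.commute)
  qed
  ultimately show thesis using that by blast
qed

lemma proj_rel_Image_scale:
  assumes "x \<in> homvecs n" "c \<noteq> 0"
  shows "proj_rel n `` {c \<cdot>\<^sub>v x} = proj_rel n `` {x}"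
proof -
  have cx: "c \<cdot>\<^sub>v x \<in> homvecs n"
  proof -
    have "x = 0\<^sub>v (n + 1)" if "c \<cdot>\<^sub>v x = 0\<^sub>v (n + 1)"
    proof -
      have "x = (1 / c) \<cdot>\<^sub>v (c \<cdot>\<^sub>v x)" using assms(2) by (simp add: smult_smult_assoc)
      also have "\<dots> = 0\<^sub>v (n + 1)" unfolding that by auto
      finally show ?thesis .
    qed
    then show ?thesis using assms(1) by (auto simp: homvecs_def)
  qed
  have "(\<exists>s. s \<noteq> 0 \<and> y = s \<cdot>\<^sub>v (c \<cdot>\<^sub>v x)) \<longleftrightarrow> (\<exists>s. s \<noteq> 0 \<and> y = s \<cdot>\<^sub>v x)" for y
  proof
    assume "\<exists>s. s \<noteq> 0 \<and> y = s \<cdot>\<^sub>v (c \<cdot>\<^sub>v x)"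
    then obtain s where "s \<noteq> 0" "y = s \<cdot>\<^sub>v (c \<cdot>\<^sub>v x)" by blast
    then show "\<exists>s. s \<noteq> 0 \<and> y = s \<cdot>\<^sub>v x"
      using assms(2) by (intro exI[of _ "s * c"]) (simp add: smult_smult_assoc)
  next
    assume "\<exists>s. s \<noteq> 0 \<and> y = s \<cdot>\<^sub>v x"
    then obtain s where "s \<noteq> 0" "y = s \<cdot>\<^sub>v x" by blast
    then show "\<exists>s. s \<noteq> 0 \<and> y = s \<cdot>\<^sub>v (c \<cdot>\<^sub>v x)"
      using assms(2) by (intro exI[of _ "s / c"]) (simp add: smult_smult_assoc)
  qed
  then show ?thesis
    using assms(1) cx by (simp add: proj_rel_def Image_def)
qed

lemma phi_vec_eq:
  assumes "is_forest j T" "is_forest_weight j T w"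
  shows "phi_vec j T w v = vec (target_dim j T + 1) (coeff (homP j T w v))"
  unfolding phi_vec_def by (simp add: hom_eval_lam[OF assms])

lemma phi_vec_homvecs:
  assumes F: "is_forest j T" and w: "is_forest_weight j T w"
    and v: "\<And>\<alpha>. \<alpha> < j \<Longrightarrow> v \<alpha> \<in> homvecs 1"
  shows "phi_vec j T w v \<in> homvecs (target_dim j T)"
proof -
  let ?m = "target_dim j T" and ?P = "homP j T w v"
  have "v \<alpha> $ 0 \<noteq> 0 \<or> v \<alpha> $ 1 \<noteq> 0" if "\<alpha> < j" for \<alpha>
  proof (rule ccontr)
    assume "\<not> ?thesis"
    then have "v \<alpha> = 0\<^sub>v (1 + 1)"
      using v[OF that] by (intro eq_vecI) (auto simp: homvecs_def less_Suc_eq)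
    then show False using v[OF that] by (simp add: homvecs_def)
  qed
  then have "?P \<noteq> 0" by (rule homP_nonzero[OF F w])
  \<comment> \<open>The leading coefficient is among the entries, since the degree is at most
    \<open>target_dim j T\<close>.\<close>
  then have "phi_vec j T w v $ degree ?P \<noteq> 0"
    using degree_homP[OF F, of w v] by (simp add: phi_vec_eq[OF F w])
  then have "phi_vec j T w v \<noteq> 0\<^sub>v (?m + 1)"
    using degree_homP[OF F, of w v] by auto
  then show ?thesis by (simp add: homvecs_def phi_vec_def)
qed

text \<open>Well-definedness: different homogeneous coordinates give proportional vectors, so the
  union that defines \<open>phi\<close> is a single class.\<close>

lemma phi_eq_class:
  assumes F: "is_forest j T" and w: "is_forest_weight j T w" and p: "p \<in> proj_line_power j"
  obtains v where "phi_vec j T w v \<in> homvecs (target_dim j T)"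
    "phi j T w p = proj_rel (target_dim j T) `` {phi_vec j T w v}"
proof -
  let ?m = "target_dim j T"
  have "\<forall>\<alpha>. \<exists>x. \<alpha> < j \<longrightarrow> x \<in> homvecs 1 \<and> p \<alpha> = proj_rel 1 `` {x}"
    using p by (auto simp: proj_line_power_def projspace_def quotient_def Pi_iff PiE_def)
  from choice[OF this] obtain v
    where v: "\<And>\<alpha>. \<alpha> < j \<Longrightarrow> v \<alpha> \<in> homvecs 1" "\<And>\<alpha>. \<alpha> < j \<Longrightarrow> p \<alpha> = proj_rel 1 `` {v \<alpha>}"
    by blast
  note phi_v = phi_vec_homvecs[where v = v, OF F w v(1)]
  \<comment> \<open>The chosen \<open>v\<close> is itself admissible, so the union is not
    empty.\<close>
  have vp: "v \<alpha> \<in> p \<alpha>" if "\<alpha> < j" for \<alpha>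
    unfolding v(2)[OF that] using v(1)[OF that]
    by (auto simp: proj_rel_def intro!: exI[of _ "1::complex"])
  have "proj_rel ?m `` {phi_vec j T w v'} = proj_rel ?m `` {phi_vec j T w v}"
    if v': "\<forall>\<alpha><j. v' \<alpha> \<in> p \<alpha>" for v'
  proof -
    have "\<forall>\<alpha>. \<exists>d. \<alpha> < j \<longrightarrow> d \<noteq> 0 \<and> v' \<alpha> = d \<cdot>\<^sub>v v \<alpha>"
      using v' v(2) by (auto simp: proj_rel_def)
    from choice[OF this] obtain d
      where d: "\<And>\<alpha>. \<alpha> < j \<Longrightarrow> d \<alpha> \<noteq> 0" "\<And>\<alpha>. \<alpha> < j \<Longrightarrow> v' \<alpha> = d \<alpha> \<cdot>\<^sub>v v \<alpha>" by blast
    have "v' \<alpha> $ 0 = d \<alpha> * v \<alpha> $ 0 \<and> v' \<alpha> $ 1 = d \<alpha> * v \<alpha> $ 1" if "\<alpha> < j" for \<alpha>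
      using v(1)[OF that] d(2)[OF that] by (auto simp: homvecs_def)
    then obtain c where c: "c \<noteq> 0" "homP j T w v' = smult c (homP j T w v)"
      using homP_scale[where v = v and v' = v' and d = d, OF _ d(1) F] by blast
    have "phi_vec j T w v' = c \<cdot>\<^sub>v phi_vec j T w v"
      unfolding phi_vec_eq[OF F w] c(2) by (intro eq_vecI) auto
    then show ?thesis
      using proj_rel_Image_scale[OF phi_v c(1)] by simp
  qed
  then have "phi j T w p = proj_rel ?m `` {phi_vec j T w v}"
    unfolding phi_def using vp by blast
  then show thesis using that phi_v by blast
qed

text \<open>Bridges vectors and polynomials: entries of a vector beyond its dimension are
  unspecified, while coefficients beyond the degree are zero.\<close>

lemma frakM_cong: "(\<And>\<kappa>. \<kappa> \<le> m \<Longrightarrow> a \<kappa> = b \<kappa>) \<Longrightarrow> frakM m a = frakM m b"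
  by (rule eq_matI) (auto simp: frakM_def Let_def)

theorem theorem5p6:
  fixes j i m :: nat
    and T :: "nat \<Rightarrow> 'v rooted_tree"
    and w :: "nat \<Rightarrow> 'v \<Rightarrow> complex"
  assumes "j \<ge> 1"
    and "is_forest j T"
    and "is_forest_weight j T w"
    and "i = card (forest_nodes j T)"
    and "m = i + j"
  shows "phi j T w ` proj_line_power j \<subseteq> Xvar m i"
proof (rule image_subsetI)
  fix p assume p: "p \<in> proj_line_power j"
  note F = assms(2) and w = assms(3)
  have m: "m = target_dim j T" by (simp add: assms target_dim_def)
  obtain v where v: "phi_vec j T w v \<in> homvecs m" "phi j T w p = proj_rel m `` {phi_vec j T w v}"
    using phi_eq_class[OF F w p] unfolding m by blast
  \<comment> \<open>\<open>Xvar\<close> demands vanishing at every representative of the class,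
    hence the scalar \<open>s\<close>.\<close>
  have "eval_int (Dpoly m \<iota>) (($) x) = 0" if "x \<in> phi j T w p" "\<iota> < i" for x \<iota>
  proof -
    obtain s where x: "x = s \<cdot>\<^sub>v phi_vec j T w v"
      using \<open>x \<in> phi j T w p\<close> v by (auto simp: proj_rel_def)
    have "frakM m (($) x) = frakM m (\<lambda>\<kappa>. s * coeff (homP j T w v) \<kappa>)"
      by (rule frakM_cong) (simp add: x phi_vec_eq[OF F w] m)
    then have "eval_int (Dpoly m \<iota>) (($) x) =
        eval_int (Dpoly m \<iota>) (\<lambda>\<kappa>. s * coeff (homP j T w v) \<kappa>)"
      by (simp only: eval_int_Dpoly)
    also have "\<dots> = 0"
      unfolding m using \<open>\<iota> < i\<close> assms by (intro eval_Dpoly_homP) auto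
    finally show ?thesis .
  qed
  moreover have "phi j T w p \<in> projspace m"
    unfolding v(2) projspace_def using v(1) by (rule quotientI)
  ultimately show "phi j T w p \<in> Xvar m i"
    by (simp add: Xvar_def)
qed

end
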